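(* Let $m\ge 1$ be an integer and let $\mathcal{H}_m$ be the two-dimensional Hammersley point set in base $2$ with $N=2^m$ points. Then $$(L_{2,2^m}(\mathcal{H}_m))^2 = \frac{m^2}{64}+\frac{29m}{192}+\frac38-\frac{m}{2^{m+4}}+\frac{1}{2^{m+2}}-\frac{1}{9\cdot 2^{2m+3}},$$ $$(L_{2,2^m}^{\mathrm{extr}}(\mathcal{H}_m))^2 = \frac{m}{64}+\frac{1}{72}-\frac{1}{9\cdot 4^{m+2}},$$ and $$(L_{2,2^m}^{\mathrm{per}}(\mathcal{H}_m))^2 = \frac{m}{16}+\frac{1}{9}+\frac{1}{9\cdot 4^{m+1}}.$$
   Context: The Hammersley point set is $$\mathcal{H}_m=\left\{\left(\frac{t_m}{2}+\dots+\frac{t_1}{2^m},\ \frac{t_1}{2}+\dots+\frac{t_m}{2^m}\right): t_1,\dots,t_m\in\{0,1\}\right\}\subset[0,1)^2.$$ Let $\mathcal{P}=\{\boldsymbol{x}_0,\dots,\boldsymbol{x}_{N-1}\}$ be an $N$-element point set in $[0,1)^2$. For measurable $B\subseteq[0,1]^2$ let $A(B,\mathcal{P})=|\{n\in\{0,\dots,N-1\}: \boldsymbol{x}_n\in B\}|$, and let $\lambda$ be Lebesgue measure. For $\boldsymbol{x}=(x_1,x_2)$ and $\boldsymbol{y}=(y_1,y_2)$ in $[0,1]^2$, $\boldsymbol{x}\le\boldsymbol{y}$ means $x_1\le y_1$ and $x_2\le y_2$, and then $[\boldsymbol{x},\boldsymbol{y})=[x_1,y_1)\times[x_2,y_2)$.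 For $x,y\in[0,1]$ set $I(x,y)=[x,y)$ if $x\le y$ and $I(x,y)=[0,y)\cup[x,1)$ if $x>y$; set $B(\boldsymbol{x},\boldsymbol{y})=I(x_1,y_1)\times I(x_2,y_2)$. Standard $L_2$ discrepancy: $$L_{2,N}(\mathcal{P})=\left(\int_{[0,1]^2}|A([\boldsymbol{0},\boldsymbol{t}),\mathcal{P})-N\lambda([\boldsymbol{0},\boldsymbol{t}))|^2\,\mathrm{d}\boldsymbol{t}\right)^{1/2}.$$ Extreme $L_2$ discrepancy: $$L_{2,N}^{\mathrm{extr}}(\mathcal{P})=\left(\int_{[0,1]^2}\int_{[0,1]^2,\ \boldsymbol{x}\le\boldsymbol{y}}|A([\boldsymbol{x},\boldsymbol{y}),\mathcal{P})-N\lambda([\boldsymbol{x},\boldsymbol{y}))|^2\,\mathrm{d}\boldsymbol{x}\,\mathrm{d}\boldsymbol{y}\right)^{1/2}.$$ Periodic $L_2$ discrepancy: $$L_{2,N}^{\mathrm{per}}(\mathcal{P})=\left(\int_{[0,1]^2}\int_{[0,1]^2}|A(B(\boldsymbol{x},\boldsymbol{y}),\mathcal{P})-N\lambda(B(\boldsymbol{x},\boldsymbol{y}))|^2\,\mathrm{d}\boldsymbol{x}\,\mathrm{d}\boldsymbol{y}\right)^{1/2}.$$ *)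

theory Defs
  imports "HOL-Analysis.Analysis"
begin

definition unit_square :: "(real \<times> real) set" where
  "unit_square = {0..1} \<times> {0..1}"

definition hammersley :: "nat \<Rightarrow> (real \<times> real) set" where
  "hammersley m =
    {(\<Sum>j=1..m. real (t (m + 1 - j)) / 2 ^ j, \<Sum>j=1..m. real (t j) / 2 ^ j) | t :: nat \<Rightarrow> nat.
       \<forall>j\<in>{1..m}. t j \<in> {0, 1}}"

definition counting :: "(real \<times> real) set \<Rightarrow> (real \<times> real) set \<Rightarrow> nat" where
  "counting B P = card {p \<in> P. p \<in> B}"

(* On pairs, < is not the componentwise strict order, so the library interval {x..<y} would
   not be a half-open box; hence the explicit product. *)
definition hbox :: "real \<times> real \<Rightarrow> real \<times> real \<Rightarrow> (real \<times> real) set" where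
  "hbox x y = {fst x..<fst y} \<times> {snd x..<snd y}"

definition per_interval :: "real \<Rightarrow> real \<Rightarrow> real set" where
  "per_interval x y = (if x \<le> y then {x..<y} else {0..<y} \<union> {x..<1})"

definition per_box :: "real \<times> real \<Rightarrow> real \<times> real \<Rightarrow> (real \<times> real) set" where
  "per_box x y = per_interval (fst x) (fst y) \<times> per_interval (snd x) (snd y)"

(* N is the number of points of P; the order used between pairs below is the
   componentwise one of HOL-Library.Product_Order. *)

definition local_discrepancy ::
    "nat \<Rightarrow> (real \<times> real) set \<Rightarrow> (real \<times> real) set \<Rightarrow> real" where
  "local_discrepancy N P B = real (counting B P) - real N * measure lborel B"

definition L2_discrepancy :: "nat \<Rightarrow> (real \<times> real) set \<Rightarrow> real" where
  "L2_discrepancy N P =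
    sqrt (LINT t:unit_square|lborel. \<bar>local_discrepancy N P (hbox (0, 0) t)\<bar>\<^sup>2)"

definition L2_extreme_discrepancy :: "nat \<Rightarrow> (real \<times> real) set \<Rightarrow> real" where
  "L2_extreme_discrepancy N P =
    sqrt (LINT y:unit_square|lborel. LINT x:{x \<in> unit_square. x \<le> y}|lborel.
            \<bar>local_discrepancy N P (hbox x y)\<bar>\<^sup>2)"

definition L2_periodic_discrepancy :: "nat \<Rightarrow> (real \<times> real) set \<Rightarrow> real" where
  "L2_periodic_discrepancy N P =
    sqrt (LINT y:unit_square|lborel. LINT x:unit_square|lborel.
            \<bar>local_discrepancy N P (per_box x y)\<bar>\<^sup>2)"

lemma less_eq_pair_componentwise:
  fixes x y :: "real \<times> real"
  shows "x \<le> y \<longleftrightarrow> fst x \<le> fst y \<and> snd x \<le> snd y"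
  by (simp add: less_eq_prod_def)

lemma binary_digits_unique:
  fixes s t :: "nat \<Rightarrow> nat"
  assumes "\<forall>j\<in>{1..m}. s j \<in> {0, 1}" "\<forall>j\<in>{1..m}. t j \<in> {0, 1}"
    and "(\<Sum>j=1..m. real (s j) / 2 ^ j) = (\<Sum>j=1..m. real (t j) / 2 ^ j)"
  shows "\<forall>j\<in>{1..m}. s j = t j"
proof -
  define v where "v = (\<lambda>n (u :: nat \<Rightarrow> nat). \<Sum>j=1..n. u j * 2 ^ (n - j))"
  have v_Suc: "v (Suc n) u = 2 * v n u + u (Suc n)" for n u
  proof -
    have "(\<Sum>j=1..n. u j * 2 ^ (Suc n - j)) = (\<Sum>j=1..n. 2 * (u j * 2 ^ (n - j)))"
      by (rule sum.cong) (auto simp: Suc_diff_le)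
    then show ?thesis
      by (simp add: v_def sum_distrib_left)
  qed
  have scale: "2 ^ n * (\<Sum>j=1..n. real (u j) / 2 ^ j) = real (v n u)" for n u
  proof -
    have "2 ^ n * (real (u j) / 2 ^ j) = real (u j * 2 ^ (n - j))" if "j \<in> {1..n}" for j
    proof -
      have "(2 :: real) ^ n = 2 ^ (n - j) * 2 ^ j"
        using that by (simp flip: power_add)
      then show ?thesis
        by simp
    qed
    then show ?thesis
      unfolding v_def sum_distrib_left of_nat_sum by (intro sum.cong) auto
  qed
  have inj: "\<forall>j\<in>{1..n}. s j = t j"
    if "v n s = v n t" "n \<le> m" for n
    using that
  proof (induction n)
    case 0
    then show ?case by simp
  next
    case (Suc n)
    have d: "s (Suc n) \<le> 1" "t (Suc n) \<le> 1"
      using assms(1,2) Suc.prems(2) by force+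
    have eq: "2 * v n s + s (Suc n) = 2 * v n t + t (Suc n)"
      using Suc.prems(1) by (simp add: v_Suc)
    have "v n s = v n t" "s (Suc n) = t (Suc n)"
      using d eq by presburger+
    then show ?case
      using Suc.IH Suc.prems(2) by (auto simp: le_Suc_eq)
  qed
  have "real (v m s) = real (v m t)"
    using assms(3) scale[of m s] scale[of m t] by simp
  then show ?thesis
    using inj[of m] by simp
qed

lemma card_hammersley: "card (hammersley m) = 2 ^ m"
proof -
  define D where "D = PiE {1..m} (\<lambda>_. {0, 1 :: nat})"
  define f where "f = (\<lambda>t :: nat \<Rightarrow> nat.
    (\<Sum>j=1..m. real (t (m + 1 - j)) / 2 ^ j, \<Sum>j=1..m. real (t j) / 2 ^ j))"
  have "hammersley m = f ` D"
  proof (intro equalityI subsetI)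
    fix p assume "p \<in> hammersley m"
    then obtain t :: "nat \<Rightarrow> nat" where t: "p = f t" "\<forall>j\<in>{1..m}. t j \<in> {0, 1}"
      unfolding hammersley_def f_def by blast
    have "f (restrict t {1..m}) = f t"
      unfolding f_def by (intro prod_eqI) (auto intro!: sum.cong)
    moreover have "restrict t {1..m} \<in> D"
      using t(2) unfolding D_def by auto
    ultimately show "p \<in> f ` D"
      using t(1) by (metis imageI)
  next
    fix p assume "p \<in> f ` D"
    then obtain t where "p = f t" "t \<in> D"
      by blast
    moreover have "\<forall>j\<in>{1..m}. t j \<in> {0, 1}"
      using \<open>t \<in> D\<close> unfolding D_def by (blast dest: PiE_mem)
    ultimately show "p \<in> hammersley m"
      unfolding hammersley_def f_def by blast
  qed
  moreover have "inj_on f D"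
  proof (rule inj_onI)
    fix s t assume st: "s \<in> D" "t \<in> D" "f s = f t"
    have "\<forall>j\<in>{1..m}. s j \<in> {0, 1}" "\<forall>j\<in>{1..m}. t j \<in> {0, 1}"
      using st(1,2) unfolding D_def by (blast dest: PiE_mem)+
    moreover have "(\<Sum>j=1..m. real (s j) / 2 ^ j) = (\<Sum>j=1..m. real (t j) / 2 ^ j)"
      using st(3) by (simp add: f_def)
    ultimately have "\<forall>j\<in>{1..m}. s j = t j"
      by (rule binary_digits_unique)
    then show "s = t"
      using st(1,2) unfolding D_def by (intro PiE_ext) auto
  qed
  moreover have "card D = 2 ^ m"
    by (simp add: D_def card_PiE numeral_2_eq_2)
  ultimately show ?thesis
    by (simp add: card_image)
qed

end

theory Submission
  imports Defs
begin

text \<open>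
  Expanding the square of the local discrepancy of a box turns each of the three integrals into
  \<open>\<Sum>\<^sub>p\<^sub>,\<^sub>q K(p\<^sub>1, q\<^sub>1) K(p\<^sub>2, q\<^sub>2) - 2N \<Sum>\<^sub>p M(p\<^sub>1) M(p\<^sub>2) + N\<^sup>2 C\<^sup>2\<close> with
  one-dimensional kernels \<open>K\<close>, \<open>M\<close> and a constant \<open>C\<close> (Warnock's formula); \<open>K(u, v)\<close> is \<open>1 - max u v\<close>, \<open>min u v (1 - max u v)\<close> and
  \<open>1/2 - \<bar>u - v\<bar> + (u - v)\<^sup>2\<close> respectively. Hence only the moments of the point set in the monomials of
  \<open>x\<close>, \<open>y\<close>, \<open>\<bar>x - x'\<bar>\<close>, \<open>\<bar>y - y'\<bar>\<close> are needed. They follow by induction from the decomposition of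
  the point set of order \<open>m + 1\<close> into the points \<open>(x/2, y)\<close> and \<open>((x + 1)/2, y + h)\<close>, where \<open>h = 2 ^ - (m + 1)\<close>
  and \<open>(x, y)\<close> runs over the point set of order \<open>m\<close>. Since \<open>\<bar>x - x'\<bar> < 1\<close>, and
  \<open>\<bar>y - y'\<bar> \<ge> 2h\<close> for distinct points, all absolute values transform linearly under this
  decomposition; the moment of \<open>(x - x') sgn (y - y')\<close> closes the system.
\<close>

section \<open>Moments of the Hammersley point set\<close>

lemma hammersley_0: "hammersley 0 = {(0, 0)}"
  by (auto simp: hammersley_def)

text \<open>The new digit \<open>t (Suc m)\<close> is the leading digit of the first coordinate and
  the last digit of the second. It pushes the old first coordinate one binary place to the right and
  adds 0 or \<open>1 / 2 ^ Suc m\<close> to the old second coordinate.\<close>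

lemma hammersley_Suc:
  "hammersley (Suc m) =
     (\<lambda>p. (fst p / 2, snd p)) ` hammersley m \<union>
     (\<lambda>p. ((fst p + 1) / 2, snd p + 1 / 2 ^ Suc m)) ` hammersley m"
proof -
  define pt where "pt = (\<lambda>m (t :: nat \<Rightarrow> nat).
    (\<Sum>j=1..m. real (t (m + 1 - j)) / 2 ^ j, \<Sum>j=1..m. real (t j) / 2 ^ j))"
  have ham: "hammersley m = {pt m t | t. \<forall>j\<in>{1..m}. t j \<in> {0, 1}}" for m
    by (simp add: hammersley_def pt_def)
  have pt_Suc: "pt (Suc m) t =
      ((fst (pt m t) + real (t (Suc m))) / 2, snd (pt m t) + real (t (Suc m)) / 2 ^ Suc m)" for t
  proof -
    \<comment> \<open>The summand \<open>j = 1\<close> carries the new digit; the other indices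
      shift by one, which produces the factor 1/2.\<close>
    have "(\<Sum>j=1..Suc m. real (t (Suc m + 1 - j)) / 2 ^ j) =
        real (t (Suc m)) / 2 + (\<Sum>j=1..m. real (t (Suc m + 1 - Suc j)) / 2 ^ Suc j)"
      by (simp add: sum.atLeast_Suc_atMost sum.atLeast_Suc_atMost_Suc_shift del: sum.cl_ivl_Suc power_Suc)
    also have "(\<Sum>j=1..m. real (t (Suc m + 1 - Suc j)) / 2 ^ Suc j) =
        (\<Sum>j=1..m. real (t (m + 1 - j)) / 2 ^ j) / 2"
      by (simp add: sum_divide_distrib mult.commute)
    finally show ?thesis
      by (simp add: pt_def add_divide_distrib)
  qed
  have pt_cong: "pt m s = pt m t" if "\<And>j. j \<in> {1..m} \<Longrightarrow> s j = t j" for s t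
  proof -
    have "s (m + 1 - j) = t (m + 1 - j)" if "j \<in> {1..m}" for j
      using that by (intro \<open>\<And>j. j \<in> {1..m} \<Longrightarrow> s j = t j\<close>) auto
    then show ?thesis
      unfolding pt_def using that
      by (intro prod_eqI) (simp_all cong: sum.cong_simp)
  qed
  show ?thesis
  proof (intro equalityI subsetI)
    fix p assume "p \<in> hammersley (Suc m)"
    then obtain t where t: "p = pt (Suc m) t" "\<forall>j\<in>{1..Suc m}. t j \<in> {0, 1}"
      unfolding ham by blast
    have digits: "\<forall>j\<in>{1..m}. t j \<in> {0, 1}" and last: "t (Suc m) = 0 \<or> t (Suc m) = 1"
      using t(2) by auto
    from digits have "pt m t \<in> hammersley m"
      unfolding ham by blast
    with last show "p \<in> (\<lambda>p. (fst p / 2, snd p)) ` hammersley m \<union>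
        (\<lambda>p. ((fst p + 1) / 2, snd p + 1 / 2 ^ Suc m)) ` hammersley m"
      unfolding t(1) pt_Suc by fastforce
  next
    have ext: "((fst p + real e) / 2, snd p + real e / 2 ^ Suc m) \<in> hammersley (Suc m)"
      if "p \<in> hammersley m" "e \<in> {0, 1}" for p e
    proof -
      obtain t where t: "p = pt m t" "\<forall>j\<in>{1..m}. t j \<in> {0, 1}"
        using \<open>p \<in> hammersley m\<close> unfolding ham by blast
      have "pt m (t(Suc m := e)) = p"
        unfolding t(1) by (rule pt_cong) auto
      then have "((fst p + real e) / 2, snd p + real e / 2 ^ Suc m) = pt (Suc m) (t(Suc m := e))"
        by (simp add: pt_Suc)
      moreover have "\<forall>j\<in>{1..Suc m}. (t(Suc m := e)) j \<in> {0, 1}"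
        using t(2) \<open>e \<in> {0, 1}\<close> by auto
      ultimately show ?thesis
        unfolding ham by blast
    qed
    fix p
    assume "p \<in> (\<lambda>p. (fst p / 2, snd p)) ` hammersley m \<union>
        (\<lambda>p. ((fst p + 1) / 2, snd p + 1 / 2 ^ Suc m)) ` hammersley m"
    then show "p \<in> hammersley (Suc m)"
      using ext[of _ 0] ext[of _ 1] by auto
  qed
qed

text \<open>Reversing the digit string exchanges the two coordinates. As the swap is an involution,
  one inclusion yields the other.\<close>

lemma hammersley_swap: "prod.swap ` hammersley m = hammersley m"
proof -
  have sub: "prod.swap ` hammersley m \<subseteq> hammersley m"
  proof (rule image_subsetI)
    fix p assume "p \<in> hammersley m"
    then obtain t :: "nat \<Rightarrow> nat" where t:
      "p = (\<Sum>j=1..m. real (t (m + 1 - j)) / 2 ^ j, \<Sum>j=1..m. real (t j) / 2 ^ j)"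
      "\<forall>j\<in>{1..m}. t j \<in> {0, 1}"
      unfolding hammersley_def by blast
    let ?s = "\<lambda>j. t (m + 1 - j)"
    have "prod.swap p = (\<Sum>j=1..m. real (?s (m + 1 - j)) / 2 ^ j, \<Sum>j=1..m. real (?s j) / 2 ^ j)"
      unfolding t(1) by (auto intro!: sum.cong)
    moreover have "\<forall>j\<in>{1..m}. ?s j \<in> {0, 1}"
      using t(2) by force
    ultimately show "prod.swap p \<in> hammersley m"
      unfolding hammersley_def by (intro CollectI exI[of _ ?s]) (rule conjI)
  qed
  then have "prod.swap ` prod.swap ` hammersley m \<subseteq> prod.swap ` hammersley m"
    by (rule image_mono)
  with sub show ?thesis
    by (simp add: image_image)
qed

lemma finite_hammersley [simp]: "finite (hammersley m)"
  by (induction m) (simp_all add: hammersley_0 hammersley_Suc)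

text \<open>The recursion preserves the bounds 0 and 1 for the first coordinate at once. For the
  second it would need the sharper upper bound \<open>1 - 1 / 2 ^ m\<close>, so the swap symmetry is
  used instead.\<close>

lemma hammersley_bounds:
  assumes "p \<in> hammersley m"
  shows "0 \<le> fst p" "fst p < 1" "0 \<le> snd p" "snd p < 1"
proof -
  have *: "0 \<le> fst p \<and> fst p < 1" if "p \<in> hammersley m" for p
    using that by (induction m arbitrary: p) (fastforce simp: hammersley_0 hammersley_Suc)+
  have "prod.swap p \<in> hammersley m"
    using assms hammersley_swap by blast
  from *[OF assms] *[OF this] show "0 \<le> fst p" "fst p < 1" "0 \<le> snd p" "snd p < 1"
    by simp_all
qed

text \<open>In one step of the recursion a difference of second coordinates stays the same or
  changes by \<open>h\<close>. A gap of at least \<open>2 * h\<close> thus remains at least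
  \<open>h\<close>, and the two descendants of one point are exactly \<open>h\<close> apart.\<close>

lemma hammersley_separation:
  assumes "p \<in> hammersley m" "q \<in> hammersley m" "p \<noteq> q"
  shows "1 / 2 ^ m \<le> \<bar>snd p - snd q\<bar>"
  using assms
proof (induction m arbitrary: p q)
  case 0
  then show ?case by (simp add: hammersley_0)
next
  case (Suc m)
  define h :: real where "h = 1 / 2 ^ Suc m"
  have h: "0 < h" "1 / 2 ^ m = 2 * h"
    by (simp_all add: h_def)
  \<comment> \<open>Distinct points of order \<open>Suc m\<close> may descend from the same point,
    so the case \<open>p = q\<close> has to be included.\<close>
  have IH: "p = q \<or> 2 * h \<le> \<bar>snd p - snd q\<bar>" if "p \<in> hammersley m" "q \<in> hammersley m" for p q
    using Suc.IH[OF that] h by auto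
  show ?case
    using Suc.prems unfolding hammersley_Suc h_def[symmetric]
    by safe (use IH h(1) in \<open>fastforce\<close>)+
qed

text \<open>The two images are disjoint: \<open>snd p = snd q + h\<close> contradicts the gap
  \<open>2 * h\<close> if \<open>p \<noteq> q\<close>, and \<open>0 < h\<close> if
  \<open>p = q\<close>.\<close>

lemma sum_hammersley_Suc:
  fixes f :: "real \<times> real \<Rightarrow> real"
  shows "(\<Sum>p\<in>hammersley (Suc m). f p) =
    (\<Sum>p\<in>hammersley m. f (fst p / 2, snd p) + f ((fst p + 1) / 2, snd p + 1 / 2 ^ Suc m))"
proof -
  define h :: real where "h = 1 / 2 ^ Suc m"
  have h: "0 < h" "1 / 2 ^ m = 2 * h"
    by (simp_all add: h_def)
  let ?lo = "\<lambda>p :: real \<times> real. (fst p / 2, snd p)"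
  let ?hi = "\<lambda>p :: real \<times> real. ((fst p + 1) / 2, snd p + h)"
  have "snd p \<noteq> snd q + h" if "p \<in> hammersley m" "q \<in> hammersley m" for p q
    using hammersley_separation[OF that] h by (cases "p = q") auto
  then have "?lo ` hammersley m \<inter> ?hi ` hammersley m = {}"
    by auto
  moreover have "inj_on ?lo (hammersley m)" "inj_on ?hi (hammersley m)"
    by (auto simp: inj_on_def prod_eq_iff)
  ultimately show ?thesis
    unfolding hammersley_Suc h_def[symmetric]
    by (simp add: sum.union_disjoint sum.reindex sum.distrib)
qed

lemma sum_hammersley_swap:
  "(\<Sum>p\<in>hammersley m. f (prod.swap p)) = (\<Sum>p\<in>hammersley m. f p)"
proof -
  have "(\<Sum>p\<in>hammersley m. f p) = (\<Sum>p\<in>prod.swap ` hammersley m. f p)"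
    by (simp add: hammersley_swap)
  also have "\<dots> = (\<Sum>p\<in>hammersley m. f (prod.swap p))"
    by (subst sum.reindex) auto
  finally show ?thesis by simp
qed

section \<open>Polynomial moments of single points\<close>

lemma sum_hammersley_x: "(\<Sum>p\<in>hammersley m. fst p) = (2 ^ m - 1) / 2"
proof (induction m)
  case (Suc m)
  have "(\<Sum>p\<in>hammersley (Suc m). fst p) = (\<Sum>p\<in>hammersley m. fst p + 1 / 2)"
    unfolding sum_hammersley_Suc by (intro sum.cong) (auto simp: field_simps)
  also have "\<dots> = (\<Sum>p\<in>hammersley m. fst p) + 2 ^ m / 2"
    by (simp add: sum.distrib card_hammersley)
  also note eq = calculation
  show ?case
    unfolding eq Suc.IH
    by (simp add: field_simps)
qed (simp add: hammersley_0)

lemma sum_hammersley_y: "(\<Sum>p\<in>hammersley m. snd p) = (2 ^ m - 1) / 2"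
  using sum_hammersley_swap[of fst m] by (simp add: sum_hammersley_x)

lemma sum_hammersley_xx: "(\<Sum>p\<in>hammersley m. (fst p)\<^sup>2) = 2 ^ m / 3 - 1 / 2 + 1 / (6 * 2 ^ m)"
proof (induction m)
  case (Suc m)
  have "(\<Sum>p\<in>hammersley (Suc m). (fst p)\<^sup>2) =
      (\<Sum>p\<in>hammersley m. 1 / 2 * (fst p)\<^sup>2 + 1 / 2 * fst p + 1 / 4)"
    unfolding sum_hammersley_Suc by (intro sum.cong) (auto simp: field_simps power2_eq_square)
  also have "\<dots> = 1 / 2 * (\<Sum>p\<in>hammersley m. (fst p)\<^sup>2) + 1 / 2 * (\<Sum>p\<in>hammersley m. fst p) + 2 ^ m / 4"
    by (simp only: sum.distrib sum_distrib_left[symmetric]) (simp add: card_hammersley)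
  also note eq = calculation
  show ?case
    unfolding eq Suc.IH sum_hammersley_x
    by (simp add: field_simps)
qed (simp add: hammersley_0)

lemma sum_hammersley_yy: "(\<Sum>p\<in>hammersley m. (snd p)\<^sup>2) = 2 ^ m / 3 - 1 / 2 + 1 / (6 * 2 ^ m)"
  using sum_hammersley_swap[of "\<lambda>p. (fst p)\<^sup>2" m] by (simp add: sum_hammersley_xx)

text \<open>The moment enters its own recursion with coefficient 1, and \<open>2 ^ m * h\<close> is
  1/2. The constant part of the increment is -1/4 + 1/8 + 1/4 = 1/8, which accumulates to the term
  \<open>m / 8\<close>.\<close>

lemma sum_hammersley_xy:
  "(\<Sum>p\<in>hammersley m. fst p * snd p) = 2 ^ m / 4 - 1 / 2 + 1 / (4 * 2 ^ m) + m / 8"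
proof (induction m)
  case (Suc m)
  define h :: real where "h = 1 / 2 ^ Suc m"
  have "(\<Sum>p\<in>hammersley (Suc m). fst p * snd p) =
      (\<Sum>p\<in>hammersley m. fst p * snd p + 1 / 2 * snd p + h / 2 * fst p + h / 2)"
    unfolding sum_hammersley_Suc h_def[symmetric] by (intro sum.cong) (auto simp: field_simps)
  also have "\<dots> = (\<Sum>p\<in>hammersley m. fst p * snd p) + 1 / 2 * (\<Sum>p\<in>hammersley m. snd p)
      + h / 2 * (\<Sum>p\<in>hammersley m. fst p) + 2 ^ m * (h / 2)"
    by (simp only: sum.distrib sum_distrib_left[symmetric]) (simp add: card_hammersley)
  also note eq = calculation
  show ?case
    unfolding eq Suc.IH sum_hammersley_x sum_hammersley_y h_def
    by (simp add: field_simps)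
qed (simp add: hammersley_0)

lemma sum_hammersley_xyy:
  "(\<Sum>p\<in>hammersley m. fst p * (snd p)\<^sup>2) =
     2 ^ m / 6 - 5 / 12 + 1 / (3 * 2 ^ m) - 1 / (12 * (2 ^ m)\<^sup>2) + m / 8 - m / (8 * 2 ^ m)"
proof (induction m)
  case (Suc m)
  define h :: real where "h = 1 / 2 ^ Suc m"
  have "(\<Sum>p\<in>hammersley (Suc m). fst p * (snd p)\<^sup>2) =
      (\<Sum>p\<in>hammersley m. fst p * (snd p)\<^sup>2 + h * (fst p * snd p) + h\<^sup>2 / 2 * fst p
         + 1 / 2 * (snd p)\<^sup>2 + h * snd p + h\<^sup>2 / 2)"
    unfolding sum_hammersley_Suc h_def[symmetric]
    by (intro sum.cong) (auto simp: field_simps power2_eq_square)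
  also have "\<dots> = (\<Sum>p\<in>hammersley m. fst p * (snd p)\<^sup>2) + h * (\<Sum>p\<in>hammersley m. fst p * snd p)
      + h\<^sup>2 / 2 * (\<Sum>p\<in>hammersley m. fst p) + 1 / 2 * (\<Sum>p\<in>hammersley m. (snd p)\<^sup>2)
      + h * (\<Sum>p\<in>hammersley m. snd p) + 2 ^ m * (h\<^sup>2 / 2)"
    by (simp only: sum.distrib sum_distrib_left[symmetric]) (simp add: card_hammersley)
  also note eq = calculation
  show ?case
    unfolding eq Suc.IH sum_hammersley_x sum_hammersley_y sum_hammersley_yy sum_hammersley_xy h_def
    by (simp add: field_simps power2_eq_square)
qed (simp add: hammersley_0)

lemma sum_hammersley_xxy:
  "(\<Sum>p\<in>hammersley m. (fst p)\<^sup>2 * snd p) =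
     2 ^ m / 6 - 5 / 12 + 1 / (3 * 2 ^ m) - 1 / (12 * (2 ^ m)\<^sup>2) + m / 8 - m / (8 * 2 ^ m)"
  using sum_hammersley_swap[of "\<lambda>p. fst p * (snd p)\<^sup>2" m]
  by (simp add: sum_hammersley_xyy mult.commute)

text \<open>Here the recursion has coefficient 1/2, so \<open>1 / 2 ^ m\<close> solves its
  homogeneous part. The lower moments contribute \<open>m / (32 * 2 ^ m)\<close> in total, and this
  resonance creates the term quadratic in \<open>m\<close>.\<close>

lemma sum_hammersley_xxyy:
  "(\<Sum>p\<in>hammersley m. (fst p)\<^sup>2 * (snd p)\<^sup>2) =
     2 ^ m / 9 - 1 / 3 + 13 / (36 * 2 ^ m) - 1 / (6 * (2 ^ m)\<^sup>2) + 1 / (36 * (2 ^ m) ^ 3)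
     + m / 8 - 9 * m / (32 * 2 ^ m) + m / (8 * (2 ^ m)\<^sup>2) + m\<^sup>2 / (32 * 2 ^ m)"
proof (induction m)
  case (Suc m)
  define h :: real where "h = 1 / 2 ^ Suc m"
  have "(\<Sum>p\<in>hammersley (Suc m). (fst p)\<^sup>2 * (snd p)\<^sup>2) =
      (\<Sum>p\<in>hammersley m. 1 / 2 * ((fst p)\<^sup>2 * (snd p)\<^sup>2) + h / 2 * ((fst p)\<^sup>2 * snd p)
         + h\<^sup>2 / 4 * (fst p)\<^sup>2 + 1 / 2 * (fst p * (snd p)\<^sup>2) + h * (fst p * snd p)
         + h\<^sup>2 / 2 * fst p + 1 / 4 * (snd p)\<^sup>2 + h / 2 * snd p + h\<^sup>2 / 4)"
    unfolding sum_hammersley_Suc h_def[symmetric]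
    by (intro sum.cong) (auto simp: field_simps power2_eq_square)
  also have "\<dots> = 1 / 2 * (\<Sum>p\<in>hammersley m. (fst p)\<^sup>2 * (snd p)\<^sup>2)
      + h / 2 * (\<Sum>p\<in>hammersley m. (fst p)\<^sup>2 * snd p) + h\<^sup>2 / 4 * (\<Sum>p\<in>hammersley m. (fst p)\<^sup>2)
      + 1 / 2 * (\<Sum>p\<in>hammersley m. fst p * (snd p)\<^sup>2) + h * (\<Sum>p\<in>hammersley m. fst p * snd p)
      + h\<^sup>2 / 2 * (\<Sum>p\<in>hammersley m. fst p) + 1 / 4 * (\<Sum>p\<in>hammersley m. (snd p)\<^sup>2)
      + h / 2 * (\<Sum>p\<in>hammersley m. snd p) + 2 ^ m * (h\<^sup>2 / 4)"
    by (simp only: sum.distrib sum_distrib_left[symmetric]) (simp add: card_hammersley)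
  also note eq = calculation
  show ?case
    unfolding eq Suc.IH sum_hammersley_x sum_hammersley_y sum_hammersley_xx sum_hammersley_yy sum_hammersley_xy sum_hammersley_xxy sum_hammersley_xyy h_def
    by (simp add: field_simps power2_eq_square power3_eq_cube)
qed (simp add: hammersley_0)

section \<open>Sums over pairs of points and their symmetries\<close>

definition hammersley_pairs ::
    "nat \<Rightarrow> (real \<times> real \<Rightarrow> real \<times> real \<Rightarrow> real) \<Rightarrow> real" where
  "hammersley_pairs m F = (\<Sum>p\<in>hammersley m. \<Sum>q\<in>hammersley m. F p q)"

lemma hammersley_pairs_add:
  "hammersley_pairs m (\<lambda>p q. F p q + G p q) = hammersley_pairs m F + hammersley_pairs m G"
  by (simp add: hammersley_pairs_def sum.distrib)

lemma hammersley_pairs_diff: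
  "hammersley_pairs m (\<lambda>p q. F p q - G p q) = hammersley_pairs m F - hammersley_pairs m G"
  by (simp add: hammersley_pairs_def sum_subtractf)

lemma hammersley_pairs_cmult:
  "hammersley_pairs m (\<lambda>p q. c * F p q) = c * hammersley_pairs m F"
  by (simp add: hammersley_pairs_def sum_distrib_left)

lemma hammersley_pairs_const: "hammersley_pairs m (\<lambda>p q. c) = (2 ^ m)\<^sup>2 * c"
  by (simp add: hammersley_pairs_def card_hammersley power2_eq_square)

lemma hammersley_pairs_left:
  "hammersley_pairs m (\<lambda>p q. f p) = 2 ^ m * (\<Sum>p\<in>hammersley m. f p)"
  by (simp add: hammersley_pairs_def card_hammersley sum_distrib_left)

lemma hammersley_pairs_right:
  "hammersley_pairs m (\<lambda>p q. f q) = 2 ^ m * (\<Sum>p\<in>hammersley m. f p)"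
  by (simp add: hammersley_pairs_def card_hammersley)

lemma hammersley_pairs_prod:
  "hammersley_pairs m (\<lambda>p q. f p * g q) = (\<Sum>p\<in>hammersley m. f p) * (\<Sum>p\<in>hammersley m. g p)"
  by (simp add: hammersley_pairs_def sum_product)

text \<open>Coincident pairs are counted separately because the shift by \<open>h\<close> pulls
  their second coordinates apart, while it preserves the order of the second coordinates of every
  other pair.\<close>

lemma hammersley_pairs_diagonal:
  "hammersley_pairs m (\<lambda>p q. of_bool (p = q)) = 2 ^ m"
proof -
  have "(\<Sum>q\<in>hammersley m. of_bool (p = q)) = (1 :: real)" if "p \<in> hammersley m" for p
    using that by (subst sum.remove[of _ p]) (auto intro: sum.neutral)
  then show ?thesis
    by (simp add: hammersley_pairs_def card_hammersley)
qed

text \<open>Unfolding these facts splits a pair sum into basic moments once its summand is a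
  combination of terms \<open>c * F p q\<close>. The summands below are spelled out in that shape
  for this reason.\<close>

lemmas hammersley_pairs_linear =
  hammersley_pairs_add hammersley_pairs_diff hammersley_pairs_cmult hammersley_pairs_const
  hammersley_pairs_diagonal

lemma hammersley_pairs_cong:
  assumes "\<And>p q. p \<in> hammersley m \<Longrightarrow> q \<in> hammersley m \<Longrightarrow> F p q = G p q"
  shows "hammersley_pairs m F = hammersley_pairs m G"
  using assms by (simp add: hammersley_pairs_def)

lemma hammersley_pairs_flip: "hammersley_pairs m (\<lambda>p q. F q p) = hammersley_pairs m F"
  unfolding hammersley_pairs_def by (rule sum.swap)

lemma hammersley_pairs_swap:
  "hammersley_pairs m (\<lambda>p q. F (prod.swap p) (prod.swap q)) = hammersley_pairs m F"
  unfolding hammersley_pairs_def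
  by (simp add: sum_hammersley_swap[of "F _"]
      sum_hammersley_swap[of "\<lambda>p. \<Sum>q\<in>hammersley m. F p q"])

section \<open>Coordinate differences under the recursion\<close>

lemma hammersley_pairs_Suc:
  "hammersley_pairs (Suc m) F = hammersley_pairs m (\<lambda>p q.
     F (fst p / 2, snd p) (fst q / 2, snd q)
     + F ((fst p + 1) / 2, snd p + 1 / 2 ^ Suc m) ((fst q + 1) / 2, snd q + 1 / 2 ^ Suc m)
     + F ((fst p + 1) / 2, snd p + 1 / 2 ^ Suc m) (fst q / 2, snd q)
     + F (fst p / 2, snd p) ((fst q + 1) / 2, snd q + 1 / 2 ^ Suc m))"
  unfolding hammersley_pairs_def sum_hammersley_Suc
  by (intro sum.cong refl) (simp add: sum.distrib)

text \<open>First coordinates differ by less than 1, so for points in different halves the sign of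
  the new difference is fixed by the halves alone and the absolute value disappears.\<close>

lemma hammersley_abs_x_step:
  assumes "p \<in> hammersley m" "q \<in> hammersley m"
  shows "\<bar>fst p / 2 - fst q / 2\<bar> = \<bar>fst p - fst q\<bar> / 2"
    and "\<bar>(fst p + 1) / 2 - (fst q + 1) / 2\<bar> = \<bar>fst p - fst q\<bar> / 2"
    and "\<bar>(fst p + 1) / 2 - fst q / 2\<bar> = (1 + (fst p - fst q)) / 2"
    and "\<bar>fst p / 2 - (fst q + 1) / 2\<bar> = (1 - (fst p - fst q)) / 2"
  using hammersley_bounds[OF assms(1)] hammersley_bounds[OF assms(2)]
  by (auto simp: field_simps abs_if)

text \<open>Distinct points are at least \<open>2 * h\<close> apart in the second coordinate, so a
  shift by \<open>h\<close> cannot change the sign of the difference. For \<open>p = q\<close> the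
  sign term vanishes and the \<open>of_bool\<close> term supplies the shift.\<close>

lemma hammersley_y_step:
  assumes "p \<in> hammersley m" "q \<in> hammersley m" and h: "h = 1 / 2 ^ Suc m"
  shows "\<bar>snd p + h - snd q\<bar> = \<bar>snd p - snd q\<bar> + h * sgn (snd p - snd q) + h * of_bool (p = q)"
    and "\<bar>snd p - (snd q + h)\<bar> = \<bar>snd p - snd q\<bar> - h * sgn (snd p - snd q) + h * of_bool (p = q)"
    and "sgn (snd p + h - snd q) = sgn (snd p - snd q) + of_bool (p = q)"
    and "sgn (snd p - (snd q + h)) = sgn (snd p - snd q) - of_bool (p = q)"
proof -
  have "0 < h" "p = q \<or> 2 * h \<le> \<bar>snd p - snd q\<bar>"
    using hammersley_separation[OF assms(1,2)] unfolding h by auto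
  then show "\<bar>snd p + h - snd q\<bar> = \<bar>snd p - snd q\<bar> + h * sgn (snd p - snd q) + h * of_bool (p = q)"
    and "\<bar>snd p - (snd q + h)\<bar> = \<bar>snd p - snd q\<bar> - h * sgn (snd p - snd q) + h * of_bool (p = q)"
    and "sgn (snd p + h - snd q) = sgn (snd p - snd q) + of_bool (p = q)"
    and "sgn (snd p - (snd q + h)) = sgn (snd p - snd q) - of_bool (p = q)"
    by (auto simp: sgn_if abs_if split: if_splits)
qed

section \<open>Moments involving absolute coordinate differences\<close>

lemma hammersley_pairs_0: "hammersley_pairs 0 F = F (0, 0) (0, 0)"
  by (simp add: hammersley_pairs_def hammersley_0)

text \<open>The two mixed terms \<open>(1 + d) / 2\<close> and \<open>(1 - d) / 2\<close> add up to
  1, and the two equal-half terms restore the old distance.\<close>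

lemma hammersley_pairs_dx:
  "hammersley_pairs m (\<lambda>p q. \<bar>fst p - fst q\<bar>) = ((2 ^ m)\<^sup>2 - 1) / 3"
proof (induction m)
  case (Suc m)
  have "hammersley_pairs (Suc m) (\<lambda>p q. \<bar>fst p - fst q\<bar>) =
      hammersley_pairs m (\<lambda>p q. \<bar>fst p - fst q\<bar> + 1)"
    unfolding hammersley_pairs_Suc fst_conv snd_conv
    by (intro hammersley_pairs_cong) (simp only: hammersley_abs_x_step, simp add: field_simps)
  also note eq = calculation
  show ?case
    unfolding eq hammersley_pairs_linear Suc.IH
    by (simp add: field_simps power2_eq_square)
qed (simp add: hammersley_pairs_0)

lemma hammersley_pairs_dy:
  "hammersley_pairs m (\<lambda>p q. \<bar>snd p - snd q\<bar>) = ((2 ^ m)\<^sup>2 - 1) / 3"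
  using hammersley_pairs_swap[of m "\<lambda>p q. \<bar>fst p - fst q\<bar>"] by (simp add: hammersley_pairs_dx)

lemma hammersley_pairs_dx_y:
  "hammersley_pairs m (\<lambda>p q. \<bar>fst p - fst q\<bar> * snd p) =
     (2 ^ m)\<^sup>2 / 6 - 2 ^ m / 6 - 1 / 6 + 1 / (6 * 2 ^ m)"
proof (induction m)
  case (Suc m)
  define h :: real where "h = 1 / 2 ^ Suc m"
  have "hammersley_pairs (Suc m) (\<lambda>p q. \<bar>fst p - fst q\<bar> * snd p) =
      hammersley_pairs m (\<lambda>p q. \<bar>fst p - fst q\<bar> * snd p + h / 2 * \<bar>fst p - fst q\<bar>
        + snd p + h / 2 + h / 2 * fst p - h / 2 * fst q)"
    unfolding hammersley_pairs_Suc fst_conv snd_conv h_def[symmetric]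
    by (intro hammersley_pairs_cong) (simp only: hammersley_abs_x_step, simp add: field_simps)
  also note eq = calculation
  show ?case
    unfolding eq hammersley_pairs_linear Suc.IH hammersley_pairs_dx
      hammersley_pairs_left hammersley_pairs_right sum_hammersley_x sum_hammersley_y h_def
    by (simp add: field_simps power2_eq_square)
qed (simp add: hammersley_pairs_0)

lemma hammersley_pairs_dx_yq:
  "hammersley_pairs m (\<lambda>p q. \<bar>fst p - fst q\<bar> * snd q) =
     (2 ^ m)\<^sup>2 / 6 - 2 ^ m / 6 - 1 / 6 + 1 / (6 * 2 ^ m)"
  using hammersley_pairs_flip[of m "\<lambda>p q. \<bar>fst p - fst q\<bar> * snd p"]
  by (simp add: hammersley_pairs_dx_y abs_minus_commute)

text \<open>The part of \<open>h * (fst p * snd p)\<close> that grows with \<open>m\<close> is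
  \<open>2 ^ m * h * (m / 8)\<close>, that is \<open>m / 16\<close> per step. It is the source of
  the term \<open>m\<^sup>2 / 32\<close>.\<close>

lemma hammersley_pairs_dx_yy:
  "hammersley_pairs m (\<lambda>p q. \<bar>fst p - fst q\<bar> * (snd p)\<^sup>2) =
     (2 ^ m)\<^sup>2 / 9 - 2 ^ m / 6 - 1 / 18 + 1 / (6 * 2 ^ m) - 1 / (18 * (2 ^ m)\<^sup>2)
     - m / 32 + m\<^sup>2 / 32"
proof (induction m)
  case (Suc m)
  define h :: real where "h = 1 / 2 ^ Suc m"
  have "hammersley_pairs (Suc m) (\<lambda>p q. \<bar>fst p - fst q\<bar> * (snd p)\<^sup>2) =
      hammersley_pairs m (\<lambda>p q. \<bar>fst p - fst q\<bar> * (snd p)\<^sup>2 + h * (\<bar>fst p - fst q\<bar> * snd p)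
        + h\<^sup>2 / 2 * \<bar>fst p - fst q\<bar> + (snd p)\<^sup>2 + h * snd p + h\<^sup>2 / 2
        + h\<^sup>2 / 2 * fst p - h\<^sup>2 / 2 * fst q + h * (fst p * snd p) - h * (snd p * fst q))"
    unfolding hammersley_pairs_Suc fst_conv snd_conv h_def[symmetric]
    by (intro hammersley_pairs_cong) (simp only: hammersley_abs_x_step, simp add: field_simps power2_eq_square)
  also note eq = calculation
  show ?case
    unfolding eq hammersley_pairs_linear Suc.IH hammersley_pairs_dx hammersley_pairs_dx_y
      hammersley_pairs_left hammersley_pairs_right hammersley_pairs_prod
      sum_hammersley_x sum_hammersley_y sum_hammersley_yy sum_hammersley_xy h_def
    by (simp add: field_simps power2_eq_square)
qed (simp add: hammersley_pairs_0)

lemma hammersley_pairs_dx_yyq: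
  "hammersley_pairs m (\<lambda>p q. \<bar>fst p - fst q\<bar> * (snd q)\<^sup>2) =
     (2 ^ m)\<^sup>2 / 9 - 2 ^ m / 6 - 1 / 18 + 1 / (6 * 2 ^ m) - 1 / (18 * (2 ^ m)\<^sup>2)
     - m / 32 + m\<^sup>2 / 32"
  using hammersley_pairs_flip[of m "\<lambda>p q. \<bar>fst p - fst q\<bar> * (snd p)\<^sup>2"]
  by (simp add: hammersley_pairs_dx_yy abs_minus_commute)

text \<open>Now the products of both coordinates of one point enter with a minus sign, each
  contributing \<open>- m / 32\<close> per step, whence the quadratic term
  \<open>- m\<^sup>2 / 32\<close>.\<close>

lemma hammersley_pairs_dx_ypyq:
  "hammersley_pairs m (\<lambda>p q. \<bar>fst p - fst q\<bar> * (snd p * snd q)) =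
     (2 ^ m)\<^sup>2 / 12 - 2 ^ m / 6 - 1 / 36 + 1 / (6 * 2 ^ m) - 1 / (18 * (2 ^ m)\<^sup>2)
     - m / 96 - m\<^sup>2 / 32"
proof (induction m)
  case (Suc m)
  define h :: real where "h = 1 / 2 ^ Suc m"
  have "hammersley_pairs (Suc m) (\<lambda>p q. \<bar>fst p - fst q\<bar> * (snd p * snd q)) =
      hammersley_pairs m (\<lambda>p q. \<bar>fst p - fst q\<bar> * (snd p * snd q)
        + h / 2 * (\<bar>fst p - fst q\<bar> * snd p) + h / 2 * (\<bar>fst p - fst q\<bar> * snd q)
        + h\<^sup>2 / 2 * \<bar>fst p - fst q\<bar> + snd p * snd q + h / 2 * snd p + h / 2 * snd q
        + h / 2 * (fst p * snd q) + h / 2 * (snd p * fst q)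
        - h / 2 * (fst p * snd p) - h / 2 * (fst q * snd q))"
    unfolding hammersley_pairs_Suc fst_conv snd_conv h_def[symmetric]
    by (intro hammersley_pairs_cong) (simp only: hammersley_abs_x_step, simp add: field_simps power2_eq_square)
  also note eq = calculation
  show ?case
    unfolding eq hammersley_pairs_linear Suc.IH hammersley_pairs_dx hammersley_pairs_dx_y
      hammersley_pairs_dx_yq
      hammersley_pairs_left hammersley_pairs_right hammersley_pairs_prod
      sum_hammersley_x sum_hammersley_y sum_hammersley_yy sum_hammersley_xy h_def
    by (simp add: field_simps power2_eq_square)
qed (simp add: hammersley_pairs_0)

text \<open>This moment records how \<open>\<bar>snd p - snd q\<bar>\<close> reacts to the shift by
  \<open>h\<close>. In the mixed terms the constants 1/2 and -1/2 cancel against \<open>sgn\<close>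
  and survive only on coincident pairs, so the recursion is S(m+1) = 2 S(m) + 2^m.\<close>

lemma hammersley_pairs_dx_sgn:
  "hammersley_pairs m (\<lambda>p q. (fst p - fst q) * sgn (snd p - snd q)) = m * 2 ^ m / 2"
proof (induction m)
  case (Suc m)
  define h :: real where "h = 1 / 2 ^ Suc m"
  have "hammersley_pairs (Suc m) (\<lambda>p q. (fst p - fst q) * sgn (snd p - snd q)) =
      hammersley_pairs m (\<lambda>p q. 2 * ((fst p - fst q) * sgn (snd p - snd q)) + of_bool (p = q))"
    unfolding hammersley_pairs_Suc fst_conv snd_conv h_def[symmetric]
    by (intro hammersley_pairs_cong)
      (simp only: hammersley_y_step(3,4)[OF _ _ h_def], simp add: field_simps)
  also note eq = calculation
  show ?case
    unfolding eq hammersley_pairs_linear Suc.IH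
    by (simp add: field_simps power2_eq_square)
qed (simp add: hammersley_pairs_0)

text \<open>The mixed terms weight \<open>\<bar>e\<bar> + h * sgn e\<close> by
  \<open>(1 + d) / 2\<close> and \<open>\<bar>e\<bar> - h * sgn e\<close> by
  \<open>(1 - d) / 2\<close>, with \<open>d\<close>, \<open>e\<close> the two coordinate
  differences. What remains is \<open>\<bar>e\<bar> + h * (d * sgn e)\<close> plus the diagonal, and
  the sign moment contributes \<open>m / 4\<close> per step.\<close>

lemma hammersley_pairs_dx_dy:
  "hammersley_pairs m (\<lambda>p q. \<bar>fst p - fst q\<bar> * \<bar>snd p - snd q\<bar>) =
     (2 ^ m)\<^sup>2 / 9 - 1 / 9 + m / 24 + m\<^sup>2 / 8"
proof (induction m)
  case (Suc m)
  define h :: real where "h = 1 / 2 ^ Suc m"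
  have "hammersley_pairs (Suc m) (\<lambda>p q. \<bar>fst p - fst q\<bar> * \<bar>snd p - snd q\<bar>) =
      hammersley_pairs m (\<lambda>p q. \<bar>fst p - fst q\<bar> * \<bar>snd p - snd q\<bar> + \<bar>snd p - snd q\<bar>
        + h * ((fst p - fst q) * sgn (snd p - snd q)) + h * of_bool (p = q))"
    unfolding hammersley_pairs_Suc fst_conv snd_conv h_def[symmetric]
    by (intro hammersley_pairs_cong)
      (simp only: hammersley_abs_x_step hammersley_y_step(1,2)[OF _ _ h_def], simp add: field_simps)
  also note eq = calculation
  show ?case
    unfolding eq hammersley_pairs_linear Suc.IH hammersley_pairs_dy hammersley_pairs_dx_sgn h_def
    by (simp add: field_simps power2_eq_square)
qed (simp add: hammersley_pairs_0)

lemma hammersley_pairs_dy_x: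
  "hammersley_pairs m (\<lambda>p q. \<bar>snd p - snd q\<bar> * fst p) =
     (2 ^ m)\<^sup>2 / 6 - 2 ^ m / 6 - 1 / 6 + 1 / (6 * 2 ^ m)"
  using hammersley_pairs_swap[of m "\<lambda>p q. \<bar>fst p - fst q\<bar> * snd p"]
  by (simp add: hammersley_pairs_dx_y)

lemma hammersley_pairs_dy_xq:
  "hammersley_pairs m (\<lambda>p q. \<bar>snd p - snd q\<bar> * fst q) =
     (2 ^ m)\<^sup>2 / 6 - 2 ^ m / 6 - 1 / 6 + 1 / (6 * 2 ^ m)"
  using hammersley_pairs_swap[of m "\<lambda>p q. \<bar>fst p - fst q\<bar> * snd q"]
  by (simp add: hammersley_pairs_dx_yq)

lemma hammersley_pairs_dy_xpxq:
  "hammersley_pairs m (\<lambda>p q. \<bar>snd p - snd q\<bar> * (fst p * fst q)) =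
     (2 ^ m)\<^sup>2 / 12 - 2 ^ m / 6 - 1 / 36 + 1 / (6 * 2 ^ m) - 1 / (18 * (2 ^ m)\<^sup>2)
     - m / 96 - m\<^sup>2 / 32"
  using hammersley_pairs_swap[of m "\<lambda>p q. \<bar>fst p - fst q\<bar> * (snd p * snd q)"]
  by (simp add: hammersley_pairs_dx_ypyq)

lemmas hammersley_pairs_moments =
  hammersley_pairs_left hammersley_pairs_right hammersley_pairs_prod
  hammersley_pairs_dx hammersley_pairs_dy hammersley_pairs_dx_dy
  hammersley_pairs_dx_y hammersley_pairs_dx_yq hammersley_pairs_dy_x hammersley_pairs_dy_xq
  hammersley_pairs_dx_yy hammersley_pairs_dx_yyq
  hammersley_pairs_dx_ypyq hammersley_pairs_dy_xpxq

lemmas sum_hammersley_moments =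
  sum_hammersley_x sum_hammersley_y sum_hammersley_xx sum_hammersley_yy
  sum_hammersley_xy sum_hammersley_xxy sum_hammersley_xyy sum_hammersley_xxyy

section \<open>Moments of squared differences, as required by the periodic kernel\<close>

lemma hammersley_pairs_sq_dx:
  "hammersley_pairs m (\<lambda>p q. (fst p - fst q)\<^sup>2) = ((2 ^ m)\<^sup>2 - 1) / 6"
proof -
  have "hammersley_pairs m (\<lambda>p q. (fst p - fst q)\<^sup>2) =
      hammersley_pairs m (\<lambda>p q. (fst p)\<^sup>2 + (fst q)\<^sup>2 - 2 * (fst p * fst q))"
    by (intro hammersley_pairs_cong) (simp add: power2_diff)
  also note eq = calculation
  show ?thesis
    unfolding eq hammersley_pairs_linear hammersley_pairs_moments sum_hammersley_moments
    by (simp add: field_simps power2_eq_square)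
qed

lemma hammersley_pairs_sq_dy:
  "hammersley_pairs m (\<lambda>p q. (snd p - snd q)\<^sup>2) = ((2 ^ m)\<^sup>2 - 1) / 6"
  using hammersley_pairs_swap[of m "\<lambda>p q. (fst p - fst q)\<^sup>2"]
  by (simp add: hammersley_pairs_sq_dx)

lemma hammersley_pairs_dx_sq_dy:
  "hammersley_pairs m (\<lambda>p q. \<bar>fst p - fst q\<bar> * (snd p - snd q)\<^sup>2) =
     ((2 ^ m)\<^sup>2 - 1) / 18 - m / 24 + m\<^sup>2 / 8"
proof -
  have "hammersley_pairs m (\<lambda>p q. \<bar>fst p - fst q\<bar> * (snd p - snd q)\<^sup>2) =
      hammersley_pairs m (\<lambda>p q. \<bar>fst p - fst q\<bar> * (snd p)\<^sup>2 + \<bar>fst p - fst q\<bar> * (snd q)\<^sup>2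
        - 2 * (\<bar>fst p - fst q\<bar> * (snd p * snd q)))"
    by (intro hammersley_pairs_cong) (simp add: power2_diff algebra_simps)
  also note eq = calculation
  show ?thesis
    unfolding eq hammersley_pairs_linear hammersley_pairs_moments
    by (simp add: field_simps)
qed

lemma hammersley_pairs_dy_sq_dx:
  "hammersley_pairs m (\<lambda>p q. \<bar>snd p - snd q\<bar> * (fst p - fst q)\<^sup>2) =
     ((2 ^ m)\<^sup>2 - 1) / 18 - m / 24 + m\<^sup>2 / 8"
  using hammersley_pairs_swap[of m "\<lambda>p q. \<bar>fst p - fst q\<bar> * (snd p - snd q)\<^sup>2"]
  by (simp add: hammersley_pairs_dx_sq_dy)

lemma hammersley_pairs_sq_dx_sq_dy:
  "hammersley_pairs m (\<lambda>p q. (fst p - fst q)\<^sup>2 * (snd p - snd q)\<^sup>2) =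
     (2 ^ m)\<^sup>2 / 36 - 1 / 18 + 1 / (36 * (2 ^ m)\<^sup>2) - m / 16 + m\<^sup>2 / 8"
proof -
  have "hammersley_pairs m (\<lambda>p q. (fst p - fst q)\<^sup>2 * (snd p - snd q)\<^sup>2) =
      hammersley_pairs m (\<lambda>p q. (fst p)\<^sup>2 * (snd p)\<^sup>2 + (fst q)\<^sup>2 * (snd q)\<^sup>2
        + (fst p)\<^sup>2 * (snd q)\<^sup>2 + (snd p)\<^sup>2 * (fst q)\<^sup>2
        - 2 * ((fst p)\<^sup>2 * snd p * snd q) - 2 * (snd p * ((fst q)\<^sup>2 * snd q))
        - 2 * (fst p * (snd p)\<^sup>2 * fst q) - 2 * (fst p * (fst q * (snd q)\<^sup>2))
        + 4 * (fst p * snd p * (fst q * snd q)))"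
    by (intro hammersley_pairs_cong) (simp add: power2_eq_square algebra_simps)
  also note eq = calculation
  show ?thesis
    unfolding eq hammersley_pairs_linear hammersley_pairs_moments sum_hammersley_moments
    by (simp add: field_simps power2_eq_square power3_eq_cube)
qed

section \<open>Warnock's formula\<close>

lemma has_bochner_integral_lborel_prod:
  fixes f g :: "real \<Rightarrow> real"
  assumes f: "has_bochner_integral lborel f a" and g: "has_bochner_integral lborel g b"
  shows "has_bochner_integral lborel (\<lambda>t :: real \<times> real. f (fst t) * g (snd t)) (a * b)"
proof -
  have int: "integrable lborel f" "integrable lborel g"
    and val: "integral\<^sup>L lborel f = a" "integral\<^sup>L lborel g = b"
    using f g by (simp_all add: has_bochner_integral_iff)
  note [measurable] = borel_measurable_integrable[OF int(1)] borel_measurable_integrable[OF int(2)]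
  have *: "integrable (lborel \<Otimes>\<^sub>M lborel) (\<lambda>t. f (fst t) * g (snd t))"
    by (rule lborel_pair.Fubini_integrable) (simp_all add: abs_mult int)
  have "integral\<^sup>L (lborel \<Otimes>\<^sub>M lborel) (\<lambda>t. f (fst t) * g (snd t)) = a * b"
    using lborel_pair.integral_fst'[OF *] by (simp add: val)
  with * show ?thesis
    by (simp add: has_bochner_integral_iff lborel_prod)
qed

lemma measure_lborel_Times:
  fixes A B :: "real set"
  assumes "A \<in> sets borel" "B \<in> sets borel"
  shows "measure lborel (A \<times> B) = measure lborel A * measure lborel B"
  using assms
  by (simp add: measure_def lborel.emeasure_pair_measure_Times enn2real_mult flip: lborel_prod)

text \<open>Half-open conditions may thus be replaced by closed intervals; \<open>X\<close> collects
  the breakpoints at which the integrands can differ.\<close>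

lemma has_bochner_integral_lborel_spike:
  fixes f g :: "real \<Rightarrow> real"
  assumes "has_bochner_integral lborel g I" "finite X" "\<And>x. x \<notin> X \<Longrightarrow> f x = g x"
  shows "has_bochner_integral lborel f I"
  using has_bochner_integral_discrete_difference[of X lborel f g I] assms
  by (auto intro: countable_finite)

lemma has_bochner_integral_quadratic:
  fixes a b c0 c1 c2 :: real
  assumes "a \<le> b"
  shows "has_bochner_integral lborel (\<lambda>x. (c0 + c1 * x + c2 * x\<^sup>2) * indicator {a..b} x)
     (c0 * (b - a) + c1 * (b\<^sup>2 - a\<^sup>2) / 2 + c2 * (b ^ 3 - a ^ 3) / 3)"
proof -
  let ?F = "\<lambda>x. c0 * x + c1 * x\<^sup>2 / 2 + c2 * x ^ 3 / 3"
  have "has_bochner_integral lborel (\<lambda>x. (c0 + c1 * x + c2 * x\<^sup>2) * indicator {a..b} x) (?F b - ?F a)"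
    using assms by (intro has_bochner_integral_FTC_Icc_real)
      (auto intro!: derivative_eq_intros simp: power2_eq_square)
  then show ?thesis
    by (simp add: algebra_simps diff_divide_distrib)
qed

section \<open>The squared discrepancy as a form with factored kernels\<close>

text \<open>The factors of the two coordinates are separate arguments, so the same form describes
  the squared discrepancy of a fixed box and its integral: integration only replaces each factor by
  its integral.\<close>

definition discrepancy_form where
  "discrepancy_form N P k1 m1 c1 k2 m2 c2 =
     (\<Sum>p\<in>P. \<Sum>q\<in>P. k1 (fst p) (fst q) * k2 (snd p) (snd q))
     - 2 * N * (\<Sum>p\<in>P. m1 (fst p) * m2 (snd p)) + N\<^sup>2 * (c1 * c2)"
  for N c1 c2 :: real and P :: "(real \<times> real) set"

text \<open>The weights \<open>w1\<close>, \<open>w2\<close> are meant for the indicators of the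
  domain of integration, which is a product as well.\<close>

lemma discrepancy_form_square:
  "(w1 * w2) * ((\<Sum>p\<in>P. a (fst p) * b (snd p)) - N * (l1 * l2))\<^sup>2 =
     discrepancy_form N P
       (\<lambda>u v. w1 * (a u * a v)) (\<lambda>u. w1 * (a u * l1)) (w1 * l1\<^sup>2)
       (\<lambda>u v. w2 * (b u * b v)) (\<lambda>u. w2 * (b u * l2)) (w2 * l2\<^sup>2)"
  unfolding discrepancy_form_def power2_diff power_mult_distrib
  unfolding power2_eq_square[of "sum _ _"] sum_product sum_distrib_left sum_distrib_right
    ring_distribs
  by (simp add: mult_ac)

text \<open>Serves the outer of two iterated integrals, where the indicator multiplies a form that
  is already integrated once.\<close>

lemma discrepancy_form_scale:
  "(w1 * w2) * discrepancy_form N P k1 m1 c1 k2 m2 c2 =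
     discrepancy_form N P
       (\<lambda>u v. w1 * k1 u v) (\<lambda>u. w1 * m1 u) (w1 * c1)
       (\<lambda>u v. w2 * k2 u v) (\<lambda>u. w2 * m2 u) (w2 * c2)"
  unfolding discrepancy_form_def sum_distrib_left ring_distribs
  by (simp add: mult_ac)

lemma has_bochner_integral_discrepancy_form:
  fixes P :: "(real \<times> real) set"
  assumes P: "P \<subseteq> {0..<1} \<times> {0..<1}"
    and "\<And>u v. u \<in> {0..<1} \<Longrightarrow> v \<in> {0..<1} \<Longrightarrow>
      has_bochner_integral lborel (\<lambda>s. k1 s u v) (K1 u v)"
    and "\<And>u. u \<in> {0..<1} \<Longrightarrow> has_bochner_integral lborel (\<lambda>s. m1 s u) (M1 u)"
    and "has_bochner_integral lborel c1 C1"
    and "\<And>u v. u \<in> {0..<1} \<Longrightarrow> v \<in> {0..<1} \<Longrightarrow>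
      has_bochner_integral lborel (\<lambda>s. k2 s u v) (K2 u v)"
    and "\<And>u. u \<in> {0..<1} \<Longrightarrow> has_bochner_integral lborel (\<lambda>s. m2 s u) (M2 u)"
    and "has_bochner_integral lborel c2 C2"
  shows "has_bochner_integral lborel
    (\<lambda>t :: real \<times> real. discrepancy_form N P
       (k1 (fst t)) (m1 (fst t)) (c1 (fst t)) (k2 (snd t)) (m2 (snd t)) (c2 (snd t)))
    (discrepancy_form N P K1 M1 C1 K2 M2 C2)"
proof -
  have "fst p \<in> {0..<1}" "snd p \<in> {0..<1}" if "p \<in> P" for p
    using that P by auto
  then show ?thesis
    unfolding discrepancy_form_def
    by (intro has_bochner_integral_add has_bochner_integral_diff has_bochner_integral_sum
        has_bochner_integral_mult_right has_bochner_integral_lborel_prod assms)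
qed

lemma counting_Times:
  assumes "finite P"
  shows "real (counting (A \<times> B) P) = (\<Sum>p\<in>P. of_bool (fst p \<in> A) * of_bool (snd p \<in> B))"
proof -
  have "(\<Sum>p\<in>P. of_bool (fst p \<in> A) * of_bool (snd p \<in> B)) = (\<Sum>p\<in>P. of_bool (p \<in> A \<times> B) :: real)"
    by (intro sum.cong) (auto simp: mem_Times_iff)
  also have "\<dots> = real (card {p \<in> P. p \<in> A \<times> B})"
    using assms by (simp add: sum_of_bool_eq Collect_conj_eq Int_commute)
  finally show ?thesis
    by (simp add: counting_def)
qed

lemma local_discrepancy_Times:
  assumes "finite P" "A \<in> sets borel" "B \<in> sets borel"
  shows "local_discrepancy N P (A \<times> B) =
    (\<Sum>p\<in>P. of_bool (fst p \<in> A) * of_bool (snd p \<in> B))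
      - real N * (measure lborel A * measure lborel B)"
  using assms by (simp add: local_discrepancy_def counting_Times measure_lborel_Times)

lemma indicator_unit_square:
  "indicator unit_square t = indicator {0..1} (fst t) * (indicator {0..1} (snd t) :: real)"
  by (cases t) (simp add: unit_square_def indicator_times)

section \<open>Kernels of the standard discrepancy\<close>

lemma standard_kernel:
  fixes u v :: real
  assumes "u \<in> {0..<1}" "v \<in> {0..<1}"
  shows "has_bochner_integral lborel
      (\<lambda>s. indicator {0..1} s * (of_bool (u \<in> {0..<s}) * of_bool (v \<in> {0..<s}))) (1 - max u v)"
proof (rule has_bochner_integral_lborel_spike)
  show "has_bochner_integral lborel
      (\<lambda>s. (1 + 0 * s + 0 * s\<^sup>2) * indicator {max u v..1} s) (1 - max u v)"
    using assms has_bochner_integral_quadratic[of "max u v" 1 1 0 0] by simp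
  \<comment> \<open>At \<open>s = max u v\<close> the half-open interval misses one of the points,
    while the closed interval \<open>{max u v..1}\<close> contains \<open>s\<close>.\<close>
  show "finite {max u v}"
    by simp
qed (use assms in \<open>auto simp: indicator_def\<close>)

lemma standard_linear:
  fixes u :: real
  assumes "u \<in> {0..<1}"
  shows "has_bochner_integral lborel
      (\<lambda>s. indicator {0..1} s * (of_bool (u \<in> {0..<s}) * s)) ((1 - u\<^sup>2) / 2)"
proof (rule has_bochner_integral_lborel_spike)
  show "has_bochner_integral lborel
      (\<lambda>s. (0 + 1 * s + 0 * s\<^sup>2) * indicator {u..1} s) ((1 - u\<^sup>2) / 2)"
    using assms has_bochner_integral_quadratic[of u 1 0 1 0] by simp
  show "finite {u}"
    by simp
qed (use assms in \<open>auto simp: indicator_def\<close>)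

lemma standard_const: "has_bochner_integral lborel (\<lambda>s :: real. indicator {0..1} s * s\<^sup>2) (1 / 3)"
  using has_bochner_integral_quadratic[of 0 1 0 0 1] by (simp add: mult.commute)

lemma L2_discrepancy_square:
  assumes "finite P" and P: "P \<subseteq> {0..<1} \<times> {0..<1}"
  shows "(L2_discrepancy N P)\<^sup>2 =
    discrepancy_form (real N) P
      (\<lambda>u v. 1 - max u v) (\<lambda>u. (1 - u\<^sup>2) / 2) (1 / 3)
      (\<lambda>u v. 1 - max u v) (\<lambda>u. (1 - u\<^sup>2) / 2) (1 / 3)" (is "_ = ?R")
proof -
  have "indicator unit_square t *\<^sub>R \<bar>local_discrepancy N P (hbox (0, 0) t)\<bar>\<^sup>2 =
      discrepancy_form (real N) P
        (\<lambda>u v. indicator {0..1} (fst t) * (of_bool (u \<in> {0..<fst t}) * of_bool (v \<in> {0..<fst t})))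
        (\<lambda>u. indicator {0..1} (fst t) * (of_bool (u \<in> {0..<fst t}) * fst t))
        (indicator {0..1} (fst t) * (fst t)\<^sup>2)
        (\<lambda>u v. indicator {0..1} (snd t) * (of_bool (u \<in> {0..<snd t}) * of_bool (v \<in> {0..<snd t})))
        (\<lambda>u. indicator {0..1} (snd t) * (of_bool (u \<in> {0..<snd t}) * snd t))
        (indicator {0..1} (snd t) * (snd t)\<^sup>2)" for t
  proof (cases "t \<in> unit_square")
    case True
    then have "local_discrepancy N P (hbox (0, 0) t) =
        (\<Sum>p\<in>P. of_bool (fst p \<in> {0..<fst t}) * of_bool (snd p \<in> {0..<snd t}))
          - real N * (fst t * snd t)"
      by (simp add: hbox_def local_discrepancy_Times[OF \<open>finite P\<close>] unit_square_def mem_Times_iff)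
    then show ?thesis
      unfolding discrepancy_form_square[symmetric] by (simp add: indicator_unit_square)
  next
    case False
    then show ?thesis
      unfolding discrepancy_form_square[symmetric] by (simp add: indicator_unit_square[symmetric])
  qed
  then have "(LINT t:unit_square|lborel. \<bar>local_discrepancy N P (hbox (0, 0) t)\<bar>\<^sup>2) = ?R"
    unfolding set_lebesgue_integral_def
    by (simp only:)
      (intro has_bochner_integral_integral_eq has_bochner_integral_discrepancy_form P
        standard_kernel standard_linear standard_const)
  \<comment> \<open>Nonnegativity is what allows squaring to undo \<open>sqrt\<close>.\<close>
  moreover have "0 \<le> (LINT t:unit_square|lborel. \<bar>local_discrepancy N P (hbox (0, 0) t)\<bar>\<^sup>2)"
    unfolding set_lebesgue_integral_def by (intro Bochner_Integration.integral_nonneg) simp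
  ultimately show ?thesis
    by (simp add: L2_discrepancy_def)
qed

section \<open>Kernels of the extreme discrepancy, first over the lower and then over the upper
  corner\<close>

text \<open>Both points lie in \<open>{x..<y}\<close> iff \<open>x \<le> min u v\<close> and
  \<open>max u v < y\<close>. The condition on \<open>x\<close> is closed, so there is no
  exceptional point.\<close>

lemma extreme_inner_kernel:
  fixes u v y :: real
  assumes "u \<in> {0..<1}" "v \<in> {0..<1}" "y \<in> {0..1}"
  shows "has_bochner_integral lborel
      (\<lambda>x. indicator {0..y} x * (of_bool (u \<in> {x..<y}) * of_bool (v \<in> {x..<y})))
      (if max u v < y then min u v else 0)"
proof (cases "max u v < y")
  case True
  show ?thesis
  proof (rule has_bochner_integral_lborel_spike)
    show "has_bochner_integral lborel (\<lambda>x. (1 + 0 * x + 0 * x\<^sup>2) * indicator {0..min u v} x)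
        (if max u v < y then min u v else 0)"
      using assms True has_bochner_integral_quadratic[of 0 "min u v" 1 0 0] by simp
    show "finite ({} :: real set)"
      by simp
  qed (use assms True in \<open>auto simp: indicator_def\<close>)
next
  case False
  then have "(\<lambda>x. indicator {0..y} x * (of_bool (u \<in> {x..<y}) * of_bool (v \<in> {x..<y}))) = (\<lambda>x. 0 :: real)"
    by auto
  with False show ?thesis
    by (simp only: if_False has_bochner_integral_zero)
qed

lemma extreme_inner_linear:
  fixes u y :: real
  assumes "u \<in> {0..<1}" "y \<in> {0..1}"
  shows "has_bochner_integral lborel
      (\<lambda>x. indicator {0..y} x * (of_bool (u \<in> {x..<y}) * (y - x)))
      (if u < y then y * u - u\<^sup>2 / 2 else 0)"
proof (cases "u < y")
  case True
  show ?thesis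
  proof (rule has_bochner_integral_lborel_spike)
    show "has_bochner_integral lborel (\<lambda>x. (y + (- 1) * x + 0 * x\<^sup>2) * indicator {0..u} x)
        (if u < y then y * u - u\<^sup>2 / 2 else 0)"
      using assms True has_bochner_integral_quadratic[of 0 u y "- 1" 0] by simp
    show "finite ({} :: real set)"
      by simp
  qed (use assms True in \<open>auto simp: indicator_def\<close>)
qed (auto simp: has_bochner_integral_zero)

lemma extreme_inner_const:
  fixes y :: real
  assumes "y \<in> {0..1}"
  shows "has_bochner_integral lborel (\<lambda>x. indicator {0..y} x * (y - x)\<^sup>2) (y ^ 3 / 3)"
  using assms has_bochner_integral_quadratic[of 0 y "y\<^sup>2" "- 2 * y" 1]
  by (simp add: algebra_simps power2_eq_square power3_eq_cube)

lemma extreme_outer_kernel: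
  fixes u v :: real
  assumes "u \<in> {0..<1}" "v \<in> {0..<1}"
  shows "has_bochner_integral lborel
      (\<lambda>y. indicator {0..1} y * (if max u v < y then min u v else 0)) (min u v * (1 - max u v))"
proof (rule has_bochner_integral_lborel_spike)
  show "has_bochner_integral lborel
      (\<lambda>y. (min u v + 0 * y + 0 * y\<^sup>2) * indicator {max u v..1} y) (min u v * (1 - max u v))"
    using assms has_bochner_integral_quadratic[of "max u v" 1 "min u v" 0 0] by simp
  show "finite {max u v}"
    by simp
qed (use assms in \<open>auto simp: indicator_def\<close>)

text \<open>This is the integral of \<open>y - x\<close> over \<open>x \<le> u < y\<close>: the area
  \<open>u * (1 - u)\<close> times the mean length \<open>(1 + u) / 2 - u / 2\<close> = 1/2.\<close>

lemma extreme_outer_linear: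
  fixes u :: real
  assumes "u \<in> {0..<1}"
  shows "has_bochner_integral lborel
      (\<lambda>y. indicator {0..1} y * (if u < y then y * u - u\<^sup>2 / 2 else 0)) (u * (1 - u) / 2)"
proof (rule has_bochner_integral_lborel_spike)
  show "has_bochner_integral lborel
      (\<lambda>y. (- (u\<^sup>2 / 2) + u * y + 0 * y\<^sup>2) * indicator {u..1} y) (u * (1 - u) / 2)"
    using assms has_bochner_integral_quadratic[of u 1 "- (u\<^sup>2 / 2)" u 0]
    by (simp add: field_simps power2_eq_square)
  show "finite {u}"
    by simp
qed (use assms in \<open>auto simp: indicator_def\<close>)

lemma extreme_outer_const:
  "has_bochner_integral lborel (\<lambda>y :: real. indicator {0..1} y * (y ^ 3 / 3)) (1 / 12)"
proof -
  \<comment> \<open>The integrand is cubic and so outside the quadratic rule; its antiderivative is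
    \<open>y ^ 4 / 12\<close>.\<close>
  have "has_bochner_integral lborel (\<lambda>y :: real. y ^ 3 / 3 * indicator {0..1} y)
      (1 ^ 4 / 12 - 0 ^ 4 / 12)"
    by (intro has_bochner_integral_FTC_Icc_real) (auto intro!: derivative_eq_intros)
  then show ?thesis
    by (simp add: mult.commute)
qed

lemma L2_extreme_discrepancy_square:
  assumes "finite P" and P: "P \<subseteq> {0..<1} \<times> {0..<1}"
  shows "(L2_extreme_discrepancy N P)\<^sup>2 =
    discrepancy_form (real N) P
      (\<lambda>u v. min u v * (1 - max u v)) (\<lambda>u. u * (1 - u) / 2) (1 / 12)
      (\<lambda>u v. min u v * (1 - max u v)) (\<lambda>u. u * (1 - u) / 2) (1 / 12)" (is "_ = ?R")
proof -
  let ?I = "\<lambda>y. LINT x:{x \<in> unit_square. x \<le> y}|lborel. \<bar>local_discrepancy N P (hbox x y)\<bar>\<^sup>2"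
  let ?K = "\<lambda>y u v. if max u v < y then min u v else (0 :: real)"
  let ?M = "\<lambda>y u. if u < y then y * u - u\<^sup>2 / 2 else (0 :: real)"
  have inner: "?I y = discrepancy_form (real N) P
      (?K (fst y)) (?M (fst y)) (fst y ^ 3 / 3) (?K (snd y)) (?M (snd y)) (snd y ^ 3 / 3)"
    if y: "y \<in> unit_square" for y
  proof -
    have y': "fst y \<in> {0..1}" "snd y \<in> {0..1}"
      using y by (auto simp: unit_square_def)
    \<comment> \<open>The order constraint acts on each coordinate separately, so the inner domain
      is again a product.\<close>
    have ind: "indicator {x \<in> unit_square. x \<le> y} x =
        indicator {0..fst y} (fst x) * (indicator {0..snd y} (snd x) :: real)" for x
      using y' by (cases x) (auto simp: unit_square_def less_eq_pair_componentwise indicator_def)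
    have "indicator {x \<in> unit_square. x \<le> y} x *\<^sub>R \<bar>local_discrepancy N P (hbox x y)\<bar>\<^sup>2 =
        discrepancy_form (real N) P
          (\<lambda>u v. indicator {0..fst y} (fst x)
             * (of_bool (u \<in> {fst x..<fst y}) * of_bool (v \<in> {fst x..<fst y})))
          (\<lambda>u. indicator {0..fst y} (fst x) * (of_bool (u \<in> {fst x..<fst y}) * (fst y - fst x)))
          (indicator {0..fst y} (fst x) * (fst y - fst x)\<^sup>2)
          (\<lambda>u v. indicator {0..snd y} (snd x)
             * (of_bool (u \<in> {snd x..<snd y}) * of_bool (v \<in> {snd x..<snd y})))
          (\<lambda>u. indicator {0..snd y} (snd x) * (of_bool (u \<in> {snd x..<snd y}) * (snd y - snd x)))
          (indicator {0..snd y} (snd x) * (snd y - snd x)\<^sup>2)" for x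
    proof (cases "x \<in> unit_square \<and> x \<le> y")
      case True
      then have "local_discrepancy N P (hbox x y) =
          (\<Sum>p\<in>P. of_bool (fst p \<in> {fst x..<fst y}) * of_bool (snd p \<in> {snd x..<snd y}))
            - real N * ((fst y - fst x) * (snd y - snd x))"
        by (simp add: hbox_def local_discrepancy_Times[OF \<open>finite P\<close>] less_eq_pair_componentwise)
      then show ?thesis
        unfolding discrepancy_form_square[symmetric] ind by simp
    next
      case False
      then show ?thesis
        unfolding discrepancy_form_square[symmetric] ind[symmetric] by simp
    qed
    then show ?thesis
      unfolding set_lebesgue_integral_def
      by (simp only:)
        (intro has_bochner_integral_integral_eq has_bochner_integral_discrepancy_form P
          extreme_inner_kernel extreme_inner_linear extreme_inner_const y')
  qed
  have "indicator unit_square y *\<^sub>R ?I y = discrepancy_form (real N) P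
      (\<lambda>u v. indicator {0..1} (fst y) * ?K (fst y) u v) (\<lambda>u. indicator {0..1} (fst y) * ?M (fst y) u)
      (indicator {0..1} (fst y) * (fst y ^ 3 / 3))
      (\<lambda>u v. indicator {0..1} (snd y) * ?K (snd y) u v) (\<lambda>u. indicator {0..1} (snd y) * ?M (snd y) u)
      (indicator {0..1} (snd y) * (snd y ^ 3 / 3))" for y
    \<comment> \<open>The value of the inner integral is known for \<open>y\<close> in the unit
      square; elsewhere the indicator makes both sides zero.\<close>
    unfolding discrepancy_form_scale[symmetric] indicator_unit_square[symmetric]
    by (cases "y \<in> unit_square") (simp_all only: inner indicator_simps scaleR_one mult_1_left scaleR_zero_left mult_zero_left
        not_False_eq_True)
  then have "(LINT y:unit_square|lborel. ?I y) = ?R"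
    unfolding set_lebesgue_integral_def[of lborel unit_square]
    by (simp only:)
      (intro has_bochner_integral_integral_eq has_bochner_integral_discrepancy_form P
        extreme_outer_kernel extreme_outer_linear extreme_outer_const)
  moreover have "0 \<le> (LINT y:unit_square|lborel. ?I y)"
    unfolding set_lebesgue_integral_def by (intro Bochner_Integration.integral_nonneg scaleR_nonneg_nonneg) simp_all
  ultimately show ?thesis
    by (simp add: L2_extreme_discrepancy_def)
qed

section \<open>Kernels of the periodic discrepancy\<close>

lemma measure_per_interval:
  assumes "x \<in> {0..1}" "y \<in> {0..1}"
  shows "measure lborel (per_interval x y) = (if x \<le> y then y - x else 1 + y - x)"
proof (cases "x \<le> y")
  case False
  have "measure lborel ({0..<y} \<union> {x..<1}) = measure lborel {0..<y} + measure lborel {x..<1}"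
    using False assms by (intro measure_Union) auto
  with False assms show ?thesis
    by (simp add: per_interval_def)
qed (simp add: per_interval_def)

lemma per_interval_borel: "per_interval x y \<in> sets borel"
  by (simp add: per_interval_def)

text \<open>Let a \<le> b be the two points. For b < y the interval contains both iff x \<le> a, or
  x > y and it wraps around. For a < y \<le> b it must wrap and y < x \<le> b; for y \<le> a it must
  wrap and y < x \<le> a.\<close>

lemma periodic_inner_kernel:
  fixes u v y :: real
  assumes "u \<in> {0..<1}" "v \<in> {0..<1}" "y \<in> {0..1}"
  shows "has_bochner_integral lborel
      (\<lambda>x. indicator {0..1} x * (of_bool (u \<in> per_interval x y) * of_bool (v \<in> per_interval x y)))
      (if max u v < y then min u v + 1 - y else if min u v < y then max u v - y else min u v - y)"
proof -
  define a b where "a = min u v" and "b = max u v"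
  have ab: "0 \<le> a" "a \<le> b" "b < 1"
    using assms by (auto simp: a_def b_def)
  have sym: "of_bool (u \<in> S) * of_bool (v \<in> S) = of_bool (a \<in> S) * (of_bool (b \<in> S) :: real)" for S
    by (auto simp: a_def b_def min_def max_def)
  consider "b < y" | "a < y" "y \<le> b" | "y \<le> a"
    by linarith
  then have "has_bochner_integral lborel
      (\<lambda>x. indicator {0..1} x * (of_bool (a \<in> per_interval x y) * of_bool (b \<in> per_interval x y)))
      (if b < y then a + 1 - y else if a < y then b - y else a - y)"
  proof cases
    case 1
    show ?thesis
    proof (rule has_bochner_integral_lborel_spike)
      show "has_bochner_integral lborel
          (\<lambda>x. (1 + 0 * x + 0 * x\<^sup>2) * indicator {0..a} x + (1 + 0 * x + 0 * x\<^sup>2) * indicator {y..1} x)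
          (if b < y then a + 1 - y else if a < y then b - y else a - y)"
        using 1 assms ab has_bochner_integral_add[OF
            has_bochner_integral_quadratic[of 0 a 1 0 0] has_bochner_integral_quadratic[of y 1 1 0 0]]
        by (simp add: algebra_simps)
      \<comment> \<open>At \<open>x = y\<close> the periodic interval is empty, although the closed
        piece \<open>{y..1}\<close> contains \<open>x\<close>.\<close>
      show "finite {y}" by simp
    qed (use 1 assms ab in \<open>auto simp: per_interval_def indicator_def\<close>)
  next
    case 2
    show ?thesis
    proof (rule has_bochner_integral_lborel_spike)
      show "has_bochner_integral lborel (\<lambda>x. (1 + 0 * x + 0 * x\<^sup>2) * indicator {y..b} x)
          (if b < y then a + 1 - y else if a < y then b - y else a - y)"
        using 2 assms ab has_bochner_integral_quadratic[of y b 1 0 0] by simp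
      show "finite {y}" by simp
    qed (use 2 assms ab in \<open>auto simp: per_interval_def indicator_def\<close>)
  next
    case 3
    show ?thesis
    proof (rule has_bochner_integral_lborel_spike)
      show "has_bochner_integral lborel (\<lambda>x. (1 + 0 * x + 0 * x\<^sup>2) * indicator {y..a} x)
          (if b < y then a + 1 - y else if a < y then b - y else a - y)"
        using 3 assms ab has_bochner_integral_quadratic[of y a 1 0 0] by simp
      show "finite {y}" by simp
    qed (use 3 assms ab in \<open>auto simp: per_interval_def indicator_def\<close>)
  qed
  then show ?thesis
    unfolding sym by (simp only: a_def b_def)
qed

lemma periodic_inner_linear:
  fixes u y :: real
  assumes "u \<in> {0..<1}" "y \<in> {0..1}"
  shows "has_bochner_integral lborel
      (\<lambda>x. indicator {0..1} x *
         (of_bool (u \<in> per_interval x y) * (if x \<le> y then y - x else 1 + y - x)))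
      (if u < y then y * u - u\<^sup>2 / 2 + (1 - y\<^sup>2) / 2 else (1 + y) * (u - y) - (u\<^sup>2 - y\<^sup>2) / 2)"
proof (cases "u < y")
  case True
  show ?thesis
  proof (rule has_bochner_integral_lborel_spike)
    show "has_bochner_integral lborel
        (\<lambda>x. (y + (- 1) * x + 0 * x\<^sup>2) * indicator {0..u} x
           + ((1 + y) + (- 1) * x + 0 * x\<^sup>2) * indicator {y..1} x)
        (if u < y then y * u - u\<^sup>2 / 2 + (1 - y\<^sup>2) / 2 else (1 + y) * (u - y) - (u\<^sup>2 - y\<^sup>2) / 2)"
      using True assms has_bochner_integral_add[OF
          has_bochner_integral_quadratic[of 0 u y "- 1" 0]
          has_bochner_integral_quadratic[of y 1 "1 + y" "- 1" 0]]
      by (simp add: field_simps power2_eq_square)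
    show "finite {y}" by simp
  qed (use True assms in \<open>auto simp: per_interval_def indicator_def\<close>)
next
  case False
  show ?thesis
  proof (rule has_bochner_integral_lborel_spike)
    show "has_bochner_integral lborel
        (\<lambda>x. ((1 + y) + (- 1) * x + 0 * x\<^sup>2) * indicator {y..u} x)
        (if u < y then y * u - u\<^sup>2 / 2 + (1 - y\<^sup>2) / 2 else (1 + y) * (u - y) - (u\<^sup>2 - y\<^sup>2) / 2)"
      using False assms has_bochner_integral_quadratic[of y u "1 + y" "- 1" 0]
      by (simp add: diff_divide_distrib algebra_simps)
    show "finite {y}" by simp
  qed (use False assms in \<open>auto simp: per_interval_def indicator_def\<close>)
qed

text \<open>For fixed \<open>y\<close> the length of the arc is \<open>y - x\<close> modulo 1, which
  is uniformly distributed, so its mean square does not depend on \<open>y\<close>.\<close>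

lemma periodic_inner_const:
  fixes y :: real
  assumes "y \<in> {0..1}"
  shows "has_bochner_integral lborel
      (\<lambda>x. indicator {0..1} x * (if x \<le> y then y - x else 1 + y - x)\<^sup>2) (1 / 3)"
proof (rule has_bochner_integral_lborel_spike)
  show "has_bochner_integral lborel
      (\<lambda>x. (y\<^sup>2 + (- 2 * y) * x + 1 * x\<^sup>2) * indicator {0..y} x
         + ((1 + y)\<^sup>2 + (- 2 * (1 + y)) * x + 1 * x\<^sup>2) * indicator {y..1} x) (1 / 3)"
    using assms has_bochner_integral_add[OF
        has_bochner_integral_quadratic[of 0 y "y\<^sup>2" "- 2 * y" 1]
        has_bochner_integral_quadratic[of y 1 "(1 + y)\<^sup>2" "- 2 * (1 + y)" 1]]
    by (simp add: field_simps power2_eq_square power3_eq_cube)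
  show "finite {y}" by simp
qed (use assms in \<open>auto simp: indicator_def power2_eq_square algebra_simps\<close>)

text \<open>The points cut the circle into arcs of length d = \<open>\<bar>u - v\<bar>\<close> and 1
  - d. A random arc contains both iff its endpoints lie in the same piece in the right order, which
  has probability d^2/2 + (1 - d)^2/2.\<close>

lemma periodic_outer_kernel:
  fixes u v :: real
  assumes "u \<in> {0..<1}" "v \<in> {0..<1}"
  shows "has_bochner_integral lborel
      (\<lambda>y. indicator {0..1} y *
         (if max u v < y then min u v + 1 - y else if min u v < y then max u v - y else min u v - y))
      (1 / 2 - \<bar>u - v\<bar> + (u - v)\<^sup>2)"
proof -
  define a b where "a = min u v" and "b = max u v"
  have ab: "0 \<le> a" "a \<le> b" "b < 1"
    using assms by (auto simp: a_def b_def)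
  have d: "1 / 2 - \<bar>u - v\<bar> + (u - v)\<^sup>2 = 1 / 2 - (b - a) + (b - a)\<^sup>2"
    by (auto simp: a_def b_def min_def max_def power2_commute)
  have "has_bochner_integral lborel
      (\<lambda>y. indicator {0..1} y * (if b < y then a + 1 - y else if a < y then b - y else a - y))
      (1 / 2 - (b - a) + (b - a)\<^sup>2)"
  proof (rule has_bochner_integral_lborel_spike)
    \<comment> \<open>The right side has exactly the shape that
      \<open>has_bochner_integral_quadratic\<close> yields on the three pieces
      \<open>{0..a}\<close>, \<open>{a..b}\<close> and \<open>{b..1}\<close>.\<close>
    have "1 / 2 - (b - a) + (b - a)\<^sup>2 =
        (a * (a - 0) + (- 1) * (a\<^sup>2 - 0\<^sup>2) / 2 + 0 * (a ^ 3 - 0 ^ 3) / 3)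
        + (b * (b - a) + (- 1) * (b\<^sup>2 - a\<^sup>2) / 2 + 0 * (b ^ 3 - a ^ 3) / 3)
        + ((a + 1) * (1 - b) + (- 1) * (1\<^sup>2 - b\<^sup>2) / 2 + 0 * (1 ^ 3 - b ^ 3) / 3)"
      by (simp add: field_simps power2_eq_square)
    then show "has_bochner_integral lborel
        (\<lambda>y. (a + (- 1) * y + 0 * y\<^sup>2) * indicator {0..a} y
           + (b + (- 1) * y + 0 * y\<^sup>2) * indicator {a..b} y
           + ((a + 1) + (- 1) * y + 0 * y\<^sup>2) * indicator {b..1} y)
        (1 / 2 - (b - a) + (b - a)\<^sup>2)"
      by (simp only:)
        (use ab in \<open>intro has_bochner_integral_add has_bochner_integral_quadratic; simp\<close>)
    show "finite {a, b}" by simp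
  qed (use ab in \<open>auto simp: indicator_def\<close>)
  then show ?thesis
    unfolding d by (simp only: a_def b_def)
qed

text \<open>By rotation invariance an arc of length l contains \<open>u\<close> with probability l,
  so the value is the mean of l^2 for uniform l, independently of \<open>u\<close>.\<close>

lemma periodic_outer_linear:
  fixes u :: real
  assumes "u \<in> {0..<1}"
  shows "has_bochner_integral lborel
      (\<lambda>y. indicator {0..1} y *
         (if u < y then y * u - u\<^sup>2 / 2 + (1 - y\<^sup>2) / 2 else (1 + y) * (u - y) - (u\<^sup>2 - y\<^sup>2) / 2))
      (1 / 3)"
proof (rule has_bochner_integral_lborel_spike)
  show "has_bochner_integral lborel
      (\<lambda>y. ((u - u\<^sup>2 / 2) + (u - 1) * y + (- 1 / 2) * y\<^sup>2) * indicator {0..u} y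
         + ((1 - u\<^sup>2) / 2 + u * y + (- 1 / 2) * y\<^sup>2) * indicator {u..1} y) (1 / 3)"
    using assms has_bochner_integral_add[OF
        has_bochner_integral_quadratic[of 0 u "u - u\<^sup>2 / 2" "u - 1" "- 1 / 2"]
        has_bochner_integral_quadratic[of u 1 "(1 - u\<^sup>2) / 2" u "- 1 / 2"]]
    by (simp add: field_simps power2_eq_square power3_eq_cube)
  show "finite {u}" by simp
qed (use assms in \<open>auto simp: indicator_def field_simps power2_eq_square\<close>)

lemma periodic_outer_const:
  "has_bochner_integral lborel (\<lambda>y :: real. indicator {0..1} y * (1 / 3 :: real)) (1 / 3)"
  using has_bochner_integral_quadratic[of 0 1 "1 / 3" 0 0] by (simp add: mult.commute)

lemma L2_periodic_discrepancy_square: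
  assumes "finite P" and P: "P \<subseteq> {0..<1} \<times> {0..<1}"
  shows "(L2_periodic_discrepancy N P)\<^sup>2 =
    discrepancy_form (real N) P
      (\<lambda>u v. 1 / 2 - \<bar>u - v\<bar> + (u - v)\<^sup>2) (\<lambda>u. 1 / 3) (1 / 3)
      (\<lambda>u v. 1 / 2 - \<bar>u - v\<bar> + (u - v)\<^sup>2) (\<lambda>u. 1 / 3) (1 / 3)" (is "_ = ?R")
proof -
  let ?I = "\<lambda>y. LINT x:unit_square|lborel. \<bar>local_discrepancy N P (per_box x y)\<bar>\<^sup>2"
  let ?l = "\<lambda>x y. if x \<le> y then y - x else 1 + y - (x :: real)"
  let ?K = "\<lambda>y u v. if max u v < y then min u v + 1 - y
    else if min u v < y then max u v - y else min u v - (y :: real)"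
  let ?M = "\<lambda>y u. if u < y then y * u - u\<^sup>2 / 2 + (1 - y\<^sup>2) / 2
    else (1 + y) * (u - y) - (u\<^sup>2 - (y :: real)\<^sup>2) / 2"
  have inner: "?I y = discrepancy_form (real N) P
      (?K (fst y)) (?M (fst y)) (1 / 3) (?K (snd y)) (?M (snd y)) (1 / 3)"
    if y: "y \<in> unit_square" for y
  proof -
    have y': "fst y \<in> {0..1}" "snd y \<in> {0..1}"
      using y by (auto simp: unit_square_def)
    have "indicator unit_square x *\<^sub>R \<bar>local_discrepancy N P (per_box x y)\<bar>\<^sup>2 =
        discrepancy_form (real N) P
          (\<lambda>u v. indicator {0..1} (fst x) * (of_bool (u \<in> per_interval (fst x) (fst y))
             * of_bool (v \<in> per_interval (fst x) (fst y))))
          (\<lambda>u. indicator {0..1} (fst x)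
             * (of_bool (u \<in> per_interval (fst x) (fst y)) * ?l (fst x) (fst y)))
          (indicator {0..1} (fst x) * (?l (fst x) (fst y))\<^sup>2)
          (\<lambda>u v. indicator {0..1} (snd x) * (of_bool (u \<in> per_interval (snd x) (snd y))
             * of_bool (v \<in> per_interval (snd x) (snd y))))
          (\<lambda>u. indicator {0..1} (snd x)
             * (of_bool (u \<in> per_interval (snd x) (snd y)) * ?l (snd x) (snd y)))
          (indicator {0..1} (snd x) * (?l (snd x) (snd y))\<^sup>2)" for x
    proof (cases "x \<in> unit_square")
      case True
      then have x': "fst x \<in> {0..1}" "snd x \<in> {0..1}"
        by (auto simp: unit_square_def)
      have "local_discrepancy N P (per_box x y) =
          (\<Sum>p\<in>P. of_bool (fst p \<in> per_interval (fst x) (fst y))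
              * of_bool (snd p \<in> per_interval (snd x) (snd y)))
            - real N * (?l (fst x) (fst y) * ?l (snd x) (snd y))"
        unfolding per_box_def
          local_discrepancy_Times[OF \<open>finite P\<close> per_interval_borel per_interval_borel]
          measure_per_interval[OF x'(1) y'(1)] measure_per_interval[OF x'(2) y'(2)] ..
      with True show ?thesis
        unfolding discrepancy_form_square[symmetric] indicator_unit_square[symmetric] by simp
    next
      case False
      then show ?thesis
        unfolding discrepancy_form_square[symmetric] indicator_unit_square[symmetric] by simp
    qed
    then show ?thesis
      unfolding set_lebesgue_integral_def
      by (simp only:)
        (intro has_bochner_integral_integral_eq has_bochner_integral_discrepancy_form P
          periodic_inner_kernel periodic_inner_linear periodic_inner_const y')
  qed
  have "indicator unit_square y *\<^sub>R ?I y = discrepancy_form (real N) P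
      (\<lambda>u v. indicator {0..1} (fst y) * ?K (fst y) u v) (\<lambda>u. indicator {0..1} (fst y) * ?M (fst y) u)
      (indicator {0..1} (fst y) * (1 / 3))
      (\<lambda>u v. indicator {0..1} (snd y) * ?K (snd y) u v) (\<lambda>u. indicator {0..1} (snd y) * ?M (snd y) u)
      (indicator {0..1} (snd y) * (1 / 3))" for y
    unfolding discrepancy_form_scale[symmetric] indicator_unit_square[symmetric]
    by (cases "y \<in> unit_square") (simp_all only: inner indicator_simps scaleR_one mult_1_left scaleR_zero_left mult_zero_left
        not_False_eq_True)
  then have "(LINT y:unit_square|lborel. ?I y) = ?R"
    \<comment> \<open>The inner integral is over \<open>unit_square\<close> too; fixing the
      integrand unfolds the outer one alone.\<close>
    unfolding set_lebesgue_integral_def[of lborel unit_square ?I]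
    by (simp only:)
      (intro has_bochner_integral_integral_eq has_bochner_integral_discrepancy_form P
        periodic_outer_kernel periodic_outer_linear periodic_outer_const)
  moreover have "0 \<le> (LINT y:unit_square|lborel. ?I y)"
    unfolding set_lebesgue_integral_def
    by (intro Bochner_Integration.integral_nonneg scaleR_nonneg_nonneg) simp_all
  ultimately show ?thesis
    by (simp add: L2_periodic_discrepancy_def)
qed

section \<open>The three discrepancies of the Hammersley point set\<close>

lemma hammersley_subset: "hammersley m \<subseteq> {0..<1} \<times> {0..<1}"
  using hammersley_bounds by (auto simp: mem_Times_iff)

lemma L2_discrepancy_hammersley:
  "(L2_discrepancy (2 ^ m) (hammersley m))\<^sup>2 =
     (real m)\<^sup>2 / 64 + 29 * real m / 192 + 3 / 8 - real m / 2 ^ (m + 4)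
       + 1 / 2 ^ (m + 2) - 1 / (9 * 2 ^ (2 * m + 3))"
proof -
  \<comment> \<open>This reduces the kernel to monomials and absolute differences, whose moments are
    known.\<close>
  have max: "max a b = (a + b + \<bar>a - b\<bar>) / 2" for a b :: real
    by (simp add: max_def)
  have pairs: "(\<Sum>p\<in>hammersley m. \<Sum>q\<in>hammersley m.
        (1 - max (fst p) (fst q)) * (1 - max (snd p) (snd q))) =
      hammersley_pairs m (\<lambda>p q.
        1 - 1 / 2 * fst p - 1 / 2 * fst q - 1 / 2 * snd p - 1 / 2 * snd q
        + 1 / 4 * (fst p * snd p) + 1 / 4 * (fst q * snd q)
        + 1 / 4 * (fst p * snd q) + 1 / 4 * (snd p * fst q)
        - 1 / 2 * \<bar>fst p - fst q\<bar> - 1 / 2 * \<bar>snd p - snd q\<bar>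
        + 1 / 4 * (\<bar>fst p - fst q\<bar> * snd p) + 1 / 4 * (\<bar>fst p - fst q\<bar> * snd q)
        + 1 / 4 * (\<bar>snd p - snd q\<bar> * fst p) + 1 / 4 * (\<bar>snd p - snd q\<bar> * fst q)
        + 1 / 4 * (\<bar>fst p - fst q\<bar> * \<bar>snd p - snd q\<bar>))"
    unfolding hammersley_pairs_def max by (intro sum.cong refl) (simp add: field_simps)
  have "(\<Sum>p\<in>hammersley m. (1 - (fst p)\<^sup>2) / 2 * ((1 - (snd p)\<^sup>2) / 2)) =
      (\<Sum>p\<in>hammersley m. 1 / 4 - 1 / 4 * (fst p)\<^sup>2 - 1 / 4 * (snd p)\<^sup>2
        + 1 / 4 * ((fst p)\<^sup>2 * (snd p)\<^sup>2))"
    by (intro sum.cong) (simp_all add: field_simps)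
  also have "\<dots> = 2 ^ m / 4 - 1 / 4 * (\<Sum>p\<in>hammersley m. (fst p)\<^sup>2)
      - 1 / 4 * (\<Sum>p\<in>hammersley m. (snd p)\<^sup>2)
      + 1 / 4 * (\<Sum>p\<in>hammersley m. (fst p)\<^sup>2 * (snd p)\<^sup>2)"
    by (simp only: sum.distrib sum_subtractf sum_distrib_left[symmetric]) (simp add: card_hammersley)
  also note single = calculation
  \<comment> \<open>With every power of 2 expressed by \<open>n\<close>, the claim becomes an
    identity of rational functions in \<open>n\<close> and \<open>m\<close>.\<close>
  define n :: real where "n = 2 ^ m"
  have n: "0 < n" "real (2 ^ m) = n" "2 ^ (m + 4) = 16 * n" "2 ^ (m + 2) = 4 * n"
      "2 ^ (2 * m + 3) = 8 * n\<^sup>2"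
    by (simp_all add: n_def power_add power_mult power2_eq_square mult.commute[of 2 m])
  show ?thesis
    unfolding L2_discrepancy_square[OF finite_hammersley hammersley_subset] discrepancy_form_def
      pairs single hammersley_pairs_linear hammersley_pairs_moments sum_hammersley_moments
      n(2-) n_def[symmetric]
    using n(1) by (simp add: field_simps power2_eq_square power3_eq_cube)
qed

lemma L2_extreme_discrepancy_hammersley:
  "(L2_extreme_discrepancy (2 ^ m) (hammersley m))\<^sup>2 =
     real m / 64 + 1 / 72 - 1 / (9 * 4 ^ (m + 2))"
proof -
  have minmax: "max a b = (a + b + \<bar>a - b\<bar>) / 2" "min a b = (a + b - \<bar>a - b\<bar>) / 2" for a b :: real
    by (simp_all add: max_def min_def)
  \<comment> \<open>With \<open>d\<close> the absolute difference, its square is polynomial in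
    \<open>a\<close> and \<open>b\<close>; the kernel is then linear in
    \<open>\<bar>a - b\<bar>\<close>.\<close>
  have "(a + b - d) / 2 * (1 - (a + b + d) / 2) = (a + b - d) / 2 - a * b"
    if "d\<^sup>2 = (a - b)\<^sup>2" for a b d :: real
    using that by (simp add: field_simps power2_eq_square)
  then have kernel: "min a b * (1 - max a b) = (a + b - \<bar>a - b\<bar>) / 2 - a * b" for a b :: real
    unfolding minmax by simp
  have pairs: "(\<Sum>p\<in>hammersley m. \<Sum>q\<in>hammersley m.
        min (fst p) (fst q) * (1 - max (fst p) (fst q))
          * (min (snd p) (snd q) * (1 - max (snd p) (snd q)))) =
      hammersley_pairs m (\<lambda>p q.
        1 / 4 * (fst p * snd p) + 1 / 4 * (fst q * snd q)
        + 1 / 4 * (fst p * snd q) + 1 / 4 * (snd p * fst q)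
        - 1 / 4 * (\<bar>fst p - fst q\<bar> * snd p) - 1 / 4 * (\<bar>fst p - fst q\<bar> * snd q)
        - 1 / 4 * (\<bar>snd p - snd q\<bar> * fst p) - 1 / 4 * (\<bar>snd p - snd q\<bar> * fst q)
        + 1 / 4 * (\<bar>fst p - fst q\<bar> * \<bar>snd p - snd q\<bar>)
        + 1 / 2 * (\<bar>fst p - fst q\<bar> * (snd p * snd q)) + 1 / 2 * (\<bar>snd p - snd q\<bar> * (fst p * fst q))
        - 1 / 2 * (fst p * snd p * snd q) - 1 / 2 * (snd p * (fst q * snd q))
        - 1 / 2 * (fst p * snd p * fst q) - 1 / 2 * (fst p * (fst q * snd q))
        + fst p * snd p * (fst q * snd q))"
    unfolding hammersley_pairs_def kernel by (intro sum.cong refl) (simp add: field_simps)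
  have "(\<Sum>p\<in>hammersley m. fst p * (1 - fst p) / 2 * (snd p * (1 - snd p) / 2)) =
      (\<Sum>p\<in>hammersley m. 1 / 4 * (fst p * snd p) - 1 / 4 * ((fst p)\<^sup>2 * snd p)
        - 1 / 4 * (fst p * (snd p)\<^sup>2) + 1 / 4 * ((fst p)\<^sup>2 * (snd p)\<^sup>2))"
    by (intro sum.cong) (simp_all add: field_simps power2_eq_square)
  also have "\<dots> = 1 / 4 * (\<Sum>p\<in>hammersley m. fst p * snd p)
      - 1 / 4 * (\<Sum>p\<in>hammersley m. (fst p)\<^sup>2 * snd p)
      - 1 / 4 * (\<Sum>p\<in>hammersley m. fst p * (snd p)\<^sup>2)
      + 1 / 4 * (\<Sum>p\<in>hammersley m. (fst p)\<^sup>2 * (snd p)\<^sup>2)"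
    by (simp only: sum.distrib sum_subtractf sum_distrib_left[symmetric])
  also note single = calculation
  define n :: real where "n = 2 ^ m"
  have "(4 :: real) ^ m = n\<^sup>2"
    by (simp add: n_def power2_eq_square flip: power_mult_distrib)
  then have n: "0 < n" "real (2 ^ m) = n" "4 ^ (m + 2) = 16 * n\<^sup>2"
    by (simp_all add: n_def power_add)
  show ?thesis
    unfolding L2_extreme_discrepancy_square[OF finite_hammersley hammersley_subset]
      discrepancy_form_def
      pairs single hammersley_pairs_linear hammersley_pairs_moments sum_hammersley_moments
      n(2-) n_def[symmetric]
    using n(1) by (simp add: field_simps power2_eq_square power3_eq_cube)
qed

lemma L2_periodic_discrepancy_hammersley:
  "(L2_periodic_discrepancy (2 ^ m) (hammersley m))\<^sup>2 =
     real m / 16 + 1 / 9 + 1 / (9 * 4 ^ (m + 1))"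
proof -
  have pairs: "(\<Sum>p\<in>hammersley m. \<Sum>q\<in>hammersley m.
        (1 / 2 - \<bar>fst p - fst q\<bar> + (fst p - fst q)\<^sup>2)
          * (1 / 2 - \<bar>snd p - snd q\<bar> + (snd p - snd q)\<^sup>2)) =
      hammersley_pairs m (\<lambda>p q.
        1 / 4 - 1 / 2 * \<bar>fst p - fst q\<bar> - 1 / 2 * \<bar>snd p - snd q\<bar>
        + \<bar>fst p - fst q\<bar> * \<bar>snd p - snd q\<bar>
        + 1 / 2 * (fst p - fst q)\<^sup>2 + 1 / 2 * (snd p - snd q)\<^sup>2
        - \<bar>fst p - fst q\<bar> * (snd p - snd q)\<^sup>2 - \<bar>snd p - snd q\<bar> * (fst p - fst q)\<^sup>2
        + (fst p - fst q)\<^sup>2 * (snd p - snd q)\<^sup>2)"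
    unfolding hammersley_pairs_def by (intro sum.cong refl) algebra
  have single: "(\<Sum>p\<in>hammersley m. 1 / 3 * (1 / 3) :: real) = 2 ^ m / 9"
    by (simp add: card_hammersley)
  define n :: real where "n = 2 ^ m"
  have "(4 :: real) ^ m = n\<^sup>2"
    by (simp add: n_def power2_eq_square flip: power_mult_distrib)
  then have n: "0 < n" "real (2 ^ m) = n" "4 ^ (m + 1) = 4 * n\<^sup>2"
    by (simp_all add: n_def power_add)
  show ?thesis
    unfolding L2_periodic_discrepancy_square[OF finite_hammersley hammersley_subset]
      discrepancy_form_def pairs single hammersley_pairs_linear hammersley_pairs_sq_dx
      hammersley_pairs_sq_dy hammersley_pairs_dx_sq_dy hammersley_pairs_dy_sq_dx
      hammersley_pairs_sq_dx_sq_dy hammersley_pairs_dx_dy hammersley_pairs_dx hammersley_pairs_dy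
      n(2-) n_def[symmetric]
    using n(1) by (simp add: field_simps power2_eq_square)
qed

theorem theorem8:
  fixes m :: nat
  assumes "m \<ge> 1"
  shows "(L2_discrepancy (2 ^ m) (hammersley m))\<^sup>2 =
           (real m)\<^sup>2 / 64 + 29 * real m / 192 + 3 / 8 - real m / 2 ^ (m + 4)
             + 1 / 2 ^ (m + 2) - 1 / (9 * 2 ^ (2 * m + 3)) \<and>
         (L2_extreme_discrepancy (2 ^ m) (hammersley m))\<^sup>2 =
           real m / 64 + 1 / 72 - 1 / (9 * 4 ^ (m + 2)) \<and>
         (L2_periodic_discrepancy (2 ^ m) (hammersley m))\<^sup>2 =
           real m / 16 + 1 / 9 + 1 / (9 * 4 ^ (m + 1))"
  by (intro conjI L2_discrepancy_hammersley L2_extreme_discrepancy_hammersley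
      L2_periodic_discrepancy_hammersley)

end
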